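(* Let $\triangle$ be a simply-laced finite Dynkin diagram, $\sigma$ a Dynkin diagram automorphism of $\triangle$ such that there is no $i\in\triangle_0$ with $i$ and $\sigma(i)$ adjacent, $\triangle_\sigma$ the folding of $\triangle$ by $\sigma$, and $\pi:\triangle_0\to(\triangle_\sigma)_0$ the projection. Then $$\widetilde{\mathfrak d}^{\,\triangle_\sigma}_{i,j}(t)=\sum_{\tilde\imath\in\pi^{-1}(i),\ \tilde\jmath\in\pi^{-1}(j)}\widetilde{\mathfrak d}^{\,\triangle}_{\tilde\imath,\tilde\jmath}(t)\qquad\text{for any } i,j\in(\triangle_\sigma)_0 .$$
   Context: For a finite (connected) Dynkin diagram $\triangle$ with vertex set $I=\triangle_0$, Cartan matrix $\mathsf C=(\mathsf c_{i,j})=(\langle h_i,\alpha_j\rangle)$, let $(\cdot,\cdot)$ be the invariant form with $(\alpha,\alpha)=2$ for short roots, $\mathsf d_i=(\alpha_i,\alpha_i)/2$, $\mathsf h$ the Coxeter number, and $i\mapsto i^*$ the involution with $w_0\alpha_i=-\alpha_{i^*}$. Define $\underline{\mathsf B}(t)=(\underline{\mathsf B}_{i,j}(t))_{i,j\in I}$ by $\underline{\mathsf B}_{i,i}(t)=\mathsf d_i^{-1}(t+t^{-1})$ and $\underline{\mathsf B}_{i,j}(t)=\mathsf c_{i,j}\mathsf d_j^{-1}$ for $i\neq j$, let $\widetilde{\underline{\mathsf B}}(t)=\underline{\mathsf B}(t)^{-1}$, and let $\widetilde{\underline{\mathsf B}}_{i,j}(t)=\sum_u\widetilde{\mathsf b}_{i,j}(u)t^u$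 be the Laurent expansion at $t=0$. Set $$\widetilde{\mathfrak d}^{\,\triangle}_{i,j}(t)=\widetilde{\underline{\mathsf B}}_{i,j}(t)+t^{\mathsf h}\,\widetilde{\underline{\mathsf B}}_{i,j^*}(t)=\sum_{u=1}^{\mathsf h}\widetilde{\mathsf b}_{i,j}(u)t^u .$$ A Dynkin diagram automorphism is a bijection $\sigma$ of $\triangle_0$ with $\langle h_i,\alpha_j\rangle=\langle h_{\sigma(i)},\alpha_{\sigma(j)}\rangle$. The folding $\triangle_\sigma$ is the Dynkin diagram whose vertices are the $\sigma$-orbits in $\triangle_0$, $\pi$ is the quotient map, and its Cartan matrix is $\mathsf c^{\triangle_\sigma}_{\pi(i),\pi(j)}=\sum_{j'\in\pi^{-1}\pi(j)}\mathsf c^{\triangle}_{i,j'}$ (so that $\mathsf d_{\pi(i)}=|\pi^{-1}\pi(i)|$). *)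

theory Defs
  imports
    "HOL-Combinatorics.Orbits"
    "HOL-Computational_Algebra.Formal_Laurent_Series"
begin

text \<open>A Dynkin diagram is given by its vertex set \<open>I\<close> and its Cartan matrix
  \<open>c i j = \<langle>h\<^sub>i, \<alpha>\<^sub>j\<rangle>\<close>; only the values of \<open>c\<close> on \<open>I\<close> matter.\<close>

definition adjacent :: "('a \<Rightarrow> 'a \<Rightarrow> int) \<Rightarrow> 'a \<Rightarrow> 'a \<Rightarrow> bool" where
  "adjacent c i j \<longleftrightarrow> i \<noteq> j \<and> c i j \<noteq> 0"

definition generalized_cartan :: "'a set \<Rightarrow> ('a \<Rightarrow> 'a \<Rightarrow> int) \<Rightarrow> bool" where
  "generalized_cartan I c \<longleftrightarrow>
     (\<forall>i\<in>I. c i i = 2) \<and>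
     (\<forall>i\<in>I. \<forall>j\<in>I. i \<noteq> j \<longrightarrow> c i j \<le> 0) \<and>
     (\<forall>i\<in>I. \<forall>j\<in>I. c i j = 0 \<longleftrightarrow> c j i = 0)"

definition finite_type :: "'a set \<Rightarrow> ('a \<Rightarrow> 'a \<Rightarrow> int) \<Rightarrow> bool" where
  "finite_type I c \<longleftrightarrow>
     (\<exists>d :: 'a \<Rightarrow> real.
        (\<forall>i\<in>I. d i > 0) \<and>
        (\<forall>i\<in>I. \<forall>j\<in>I. d i * of_int (c i j) = d j * of_int (c j i)) \<and>
        (\<forall>x :: 'a \<Rightarrow> real. (\<exists>i\<in>I. x i \<noteq> 0) \<longrightarrow>
           (\<Sum>i\<in>I. \<Sum>j\<in>I. d i * of_int (c i j) * x i * x j) > 0))"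

definition connected_diagram :: "'a set \<Rightarrow> ('a \<Rightarrow> 'a \<Rightarrow> int) \<Rightarrow> bool" where
  "connected_diagram I c \<longleftrightarrow>
     I \<noteq> {} \<and> (\<forall>i\<in>I. \<forall>j\<in>I. (i, j) \<in> {(k, l). k \<in> I \<and> l \<in> I \<and> adjacent c k l}\<^sup>*)"

definition finite_dynkin :: "'a set \<Rightarrow> ('a \<Rightarrow> 'a \<Rightarrow> int) \<Rightarrow> bool" where
  "finite_dynkin I c \<longleftrightarrow>
     finite I \<and> generalized_cartan I c \<and> finite_type I c \<and> connected_diagram I c"

definition simply_laced :: "'a set \<Rightarrow> ('a \<Rightarrow> 'a \<Rightarrow> int) \<Rightarrow> bool" where
  "simply_laced I c \<longleftrightarrow> (\<forall>i\<in>I. \<forall>j\<in>I. i \<noteq> j \<longrightarrow> c i j \<in> {0, -1})"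

subsection \<open>Weyl group and roots\<close>

text \<open>An element of the root lattice is represented by its family of coefficients in the basis of
  simple roots. Reflections leave the coordinates outside \<open>I\<close> alone, so Weyl group elements that
  agree on the root lattice are equal as functions.\<close>

definition simple_root :: "'a \<Rightarrow> 'a \<Rightarrow> int" where
  "simple_root i = (\<lambda>j. if j = i then 1 else 0)"

definition reflection :: "'a set \<Rightarrow> ('a \<Rightarrow> 'a \<Rightarrow> int) \<Rightarrow> 'a \<Rightarrow> ('a \<Rightarrow> int) \<Rightarrow> ('a \<Rightarrow> int)" where
  "reflection I c i \<beta> = (\<lambda>k. \<beta> k - (\<Sum>j\<in>I. \<beta> j * c i j) * simple_root i k)"

definition word_action :: "'a set \<Rightarrow> ('a \<Rightarrow> 'a \<Rightarrow> int) \<Rightarrow> 'a list \<Rightarrow> ('a \<Rightarrow> int) \<Rightarrow> ('a \<Rightarrow> int)" where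
  "word_action I c xs = foldr (\<lambda>i w. reflection I c i \<circ> w) xs id"

definition weyl_group :: "'a set \<Rightarrow> ('a \<Rightarrow> 'a \<Rightarrow> int) \<Rightarrow> (('a \<Rightarrow> int) \<Rightarrow> ('a \<Rightarrow> int)) set" where
  "weyl_group I c = word_action I c ` lists I"

definition roots :: "'a set \<Rightarrow> ('a \<Rightarrow> 'a \<Rightarrow> int) \<Rightarrow> ('a \<Rightarrow> int) set" where
  "roots I c = {w (simple_root i) | w i. w \<in> weyl_group I c \<and> i \<in> I}"

definition weyl_length :: "'a set \<Rightarrow> ('a \<Rightarrow> 'a \<Rightarrow> int) \<Rightarrow> (('a \<Rightarrow> int) \<Rightarrow> ('a \<Rightarrow> int)) \<Rightarrow> nat" where
  "weyl_length I c w = (LEAST n. \<exists>xs\<in>lists I. length xs = n \<and> word_action I c xs = w)"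

definition longest_element :: "'a set \<Rightarrow> ('a \<Rightarrow> 'a \<Rightarrow> int) \<Rightarrow> ('a \<Rightarrow> int) \<Rightarrow> ('a \<Rightarrow> int)" where
  "longest_element I c =
     (THE w. w \<in> weyl_group I c \<and> (\<forall>v\<in>weyl_group I c. weyl_length I c v \<le> weyl_length I c w))"

definition dynkin_star :: "'a set \<Rightarrow> ('a \<Rightarrow> 'a \<Rightarrow> int) \<Rightarrow> 'a \<Rightarrow> 'a" where
  "dynkin_star I c i =
     (THE j. j \<in> I \<and> longest_element I c (simple_root i) = (\<lambda>k. - simple_root j k))"

text \<open>The Coxeter number is the order of a Coxeter element, i.e. of a product of all simple
  reflections, each taken once; the order does not depend on how they are arranged.\<close>

definition coxeter_number :: "'a set \<Rightarrow> ('a \<Rightarrow> 'a \<Rightarrow> int) \<Rightarrow> nat" where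
  "coxeter_number I c =
     (THE h. \<forall>xs. distinct xs \<and> set xs = I \<longrightarrow>
        h = (LEAST n. n > 0 \<and> (word_action I c xs ^^ n) = id))"

subsection \<open>The normalized invariant form\<close>

text \<open>A bilinear form is given by its Gram matrix \<open>G i j = (\<alpha>\<^sub>i, \<alpha>\<^sub>j)\<close>.
  The short roots are the roots of minimal length; if there is only one root length,
  all roots are short.\<close>

definition bilinear_form ::
    "'a set \<Rightarrow> ('a \<Rightarrow> 'a \<Rightarrow> rat) \<Rightarrow> ('a \<Rightarrow> int) \<Rightarrow> ('a \<Rightarrow> int) \<Rightarrow> rat" where
  "bilinear_form I G \<beta> \<gamma> = (\<Sum>i\<in>I. \<Sum>j\<in>I. of_int (\<beta> i) * G i j * of_int (\<gamma> j))"

definition normalized_invariant_form ::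
    "'a set \<Rightarrow> ('a \<Rightarrow> 'a \<Rightarrow> int) \<Rightarrow> ('a \<Rightarrow> 'a \<Rightarrow> rat) \<Rightarrow> bool" where
  "normalized_invariant_form I c G \<longleftrightarrow>
     (\<forall>i\<in>I. \<forall>j\<in>I. G i j = G j i) \<and>
     (\<forall>w\<in>weyl_group I c. \<forall>\<beta> \<gamma>. bilinear_form I G (w \<beta>) (w \<gamma>) = bilinear_form I G \<beta> \<gamma>) \<and>
     Min ((\<lambda>\<alpha>. bilinear_form I G \<alpha> \<alpha>) ` roots I c) = 2"

definition half_norm :: "'a set \<Rightarrow> ('a \<Rightarrow> 'a \<Rightarrow> int) \<Rightarrow> 'a \<Rightarrow> rat" where
  "half_norm I c i =
     (THE r. \<exists>G. normalized_invariant_form I c G \<and>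
        r = bilinear_form I G (simple_root i) (simple_root i) / 2)"

subsection \<open>The matrix \<open>B(t)\<close> and its inverse\<close>

text \<open>Rational functions in \<open>t\<close> are identified with their Laurent expansions at \<open>t = 0\<close>. Since
  this is an embedding of fields, the inverse of \<open>B(t)\<close> computed over formal Laurent series is the
  entrywise Laurent expansion of the inverse over rational functions.\<close>

definition B_matrix :: "'a set \<Rightarrow> ('a \<Rightarrow> 'a \<Rightarrow> int) \<Rightarrow> 'a \<Rightarrow> 'a \<Rightarrow> rat fls" where
  "B_matrix I c i j =
     (if i = j then fls_const (inverse (half_norm I c i)) * (fls_X + fls_X_inv)
      else fls_const (of_int (c i j) * inverse (half_norm I c j)))"

definition matrix_inverse_on :: "'a set \<Rightarrow> ('a \<Rightarrow> 'a \<Rightarrow> 'b::field) \<Rightarrow> 'a \<Rightarrow> 'a \<Rightarrow> 'b" where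
  "matrix_inverse_on I M =
     (THE N. (\<forall>i\<in>I. \<forall>j\<in>I. (\<Sum>k\<in>I. M i k * N k j) = (if i = j then 1 else 0)) \<and>
             (\<forall>i\<in>I. \<forall>j\<in>I. (\<Sum>k\<in>I. N i k * M k j) = (if i = j then 1 else 0)) \<and>
             (\<forall>i j. i \<notin> I \<or> j \<notin> I \<longrightarrow> N i j = 0))"

definition B_tilde :: "'a set \<Rightarrow> ('a \<Rightarrow> 'a \<Rightarrow> int) \<Rightarrow> 'a \<Rightarrow> 'a \<Rightarrow> rat fls" where
  "B_tilde I c = matrix_inverse_on I (B_matrix I c)"

definition d_tilde :: "'a set \<Rightarrow> ('a \<Rightarrow> 'a \<Rightarrow> int) \<Rightarrow> 'a \<Rightarrow> 'a \<Rightarrow> rat fls" where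
  "d_tilde I c i j =
     B_tilde I c i j + fls_X ^ coxeter_number I c * B_tilde I c i (dynkin_star I c j)"

subsection \<open>Folding\<close>

definition diagram_automorphism :: "'a set \<Rightarrow> ('a \<Rightarrow> 'a \<Rightarrow> int) \<Rightarrow> ('a \<Rightarrow> 'a) \<Rightarrow> bool" where
  "diagram_automorphism I c \<sigma> \<longleftrightarrow>
     bij_betw \<sigma> I I \<and> (\<forall>i\<in>I. \<forall>j\<in>I. c (\<sigma> i) (\<sigma> j) = c i j)"

text \<open>The projection sends a vertex \<open>i\<close> to its orbit \<open>{\<sigma> i, \<sigma> (\<sigma> i), \<dots>}\<close>, which contains \<open>i\<close>
  because \<open>\<sigma>\<close> permutes a finite set.\<close>

definition fold_vertices :: "'a set \<Rightarrow> ('a \<Rightarrow> 'a) \<Rightarrow> 'a set set" where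
  "fold_vertices I \<sigma> = orbit \<sigma> ` I"

definition fold_fibre :: "'a set \<Rightarrow> ('a \<Rightarrow> 'a) \<Rightarrow> 'a set \<Rightarrow> 'a set" where
  "fold_fibre I \<sigma> p = {i \<in> I. orbit \<sigma> i = p}"

text \<open>The value does not depend on the representative chosen for the row orbit.\<close>

definition fold_cartan ::
    "'a set \<Rightarrow> ('a \<Rightarrow> 'a \<Rightarrow> int) \<Rightarrow> ('a \<Rightarrow> 'a) \<Rightarrow> 'a set \<Rightarrow> 'a set \<Rightarrow> int" where
  "fold_cartan I c \<sigma> p q = (\<Sum>j\<in>fold_fibre I \<sigma> q. c (SOME i. i \<in> fold_fibre I \<sigma> p) j)"

end

theory Submission
  imports Defs
begin

text \<open>Vectors on the root lattice of \<open>\<triangle>\<^sub>\<sigma>\<close> are \<open>\<sigma>\<close>-invariant vectors on the root lattice of \<open>\<triangle>\<close>,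
  and the simple reflection of an orbit is the product of the commuting simple reflections of its
  members. So Weyl group words of \<open>\<triangle>\<^sub>\<sigma>\<close> lift to words of \<open>\<triangle>\<close> commuting with \<open>\<sigma>\<close>. A lifted word
  gives the same sign to all simple roots of one orbit, and a Weyl group element preserving the
  positivity of all simple roots is trivial; hence a word is trivial iff its lift is, which gives
  equality of the Coxeter numbers, and the longest element lifts to the longest element, which
  identifies the two involutions \<open>i \<mapsto> i\<^sup>*\<close>.

  Since \<open>\<triangle>\<close> is a tree in which no vertex is adjacent to its image, \<open>\<sigma>\<close> fixes a vertex and no two
  vertices of an orbit are adjacent; therefore \<open>\<triangle>\<^sub>\<sigma>\<close> is again of finite type, with \<open>d\<^sub>p = |p|\<close>.
  Finally, summing the \<open>\<sigma>\<close>-invariant inverse of \<open>B(t)\<close> over pairs of orbits yields the inverse of the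
  folded matrix.\<close>

subsection \<open>Weyl groups of Cartan matrices with sign-coherent roots\<close>

text \<open>The longest element, the involution, the Coxeter number, the half norms and the inverse
  matrix are definite descriptions, so existence and uniqueness must be settled before the diagrams
  can be compared. Both diagrams share one theory because sign coherence of roots is a locale axiom.
  On \<triangle> it holds because every root has norm 2, the least positive value of an even form;
  the folding may have longer roots, and there coherence is inherited: a folded simple root is a sum
  over one orbit, and the images of the summands cannot cancel. The fixed vertex serves two ends.
  Its orbit has size 1, so |p| is the normalisation with short roots of norm 2. It also rules out
  edges inside an orbit: two members of one orbit are reached from it by walks of equal length, and
  an edge between them would close an odd walk. In the last part, the weight 1/|q| in column q of
  the folded matrix cancels the factor |q| that arises when an orbit-constant function is summed
  over q.\<close>

definition pairing :: "'a set \<Rightarrow> ('a \<Rightarrow> 'a \<Rightarrow> int) \<Rightarrow> 'a \<Rightarrow> ('a \<Rightarrow> int) \<Rightarrow> int" where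
  "pairing I c i \<beta> = (\<Sum>j\<in>I. \<beta> j * c i j)"

lemma reflection_eq: "reflection I c i \<beta> = (\<lambda>k. \<beta> k - pairing I c i \<beta> * simple_root i k)"
  by (simp add: reflection_def pairing_def)

lemma word_action_Nil [simp]: "word_action I c [] = id"
  and word_action_Cons [simp]: "word_action I c (x # xs) = reflection I c x \<circ> word_action I c xs"
  by (simp_all add: word_action_def)

lemma word_action_append: "word_action I c (xs @ ys) = word_action I c xs \<circ> word_action I c ys"
  by (induction xs) (auto simp: o_assoc)

lemma word_action_snoc: "word_action I c (xs @ [x]) = word_action I c xs \<circ> reflection I c x"
  by (auto simp: word_action_append)

lemma simple_root_simps [simp]: "simple_root i i = 1" "k \<noteq> i \<Longrightarrow> simple_root i k = 0"
  by (simp_all add: simple_root_def)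

lemma pairing_simple_root [simp]:
  assumes "finite I" "j \<in> I"
  shows "pairing I c i (simple_root j) = c i j"
proof -
  have "pairing I c i (simple_root j) = (\<Sum>k\<in>I. if k = j then c i k else 0)"
    unfolding pairing_def by (rule sum.cong) (auto simp: simple_root_def)
  then show ?thesis using assms by simp
qed

lemma pairing_sum:
  "pairing I c i (\<lambda>k. \<Sum>a\<in>A. f a * g a k) = (\<Sum>a\<in>A. f a * pairing I c i (g a))"
  unfolding pairing_def
  by (simp add: sum_distrib_left sum_distrib_right mult.assoc) (rule sum.swap)

lemma word_action_outside:
  assumes "set xs \<subseteq> I" "k \<notin> I"
  shows "word_action I c xs \<beta> k = \<beta> k"
  using assms by (induction xs) (auto simp: reflection_eq simple_root_def)

text \<open>The source of all linearity used below: scaling is the case of a one-element index set,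
  a difference the case of the index type \<open>bool\<close>.\<close>

lemma word_action_sum:
  "word_action I c xs (\<lambda>k. \<Sum>a\<in>A. f a * g a k) = (\<lambda>k. \<Sum>a\<in>A. f a * word_action I c xs (g a) k)"
proof (induction xs)
  case (Cons x xs)
  show ?case
    unfolding word_action_Cons o_apply Cons reflection_eq pairing_sum
    by (simp add: right_diff_distrib sum_subtractf sum_distrib_right mult.assoc)
qed auto

lemma word_action_scale: "word_action I c xs (\<lambda>k. m * \<beta> k) = (\<lambda>k. m * word_action I c xs \<beta> k)"
  using word_action_sum[where A = "{()}" and f = "\<lambda>_. m" and g = "\<lambda>_. \<beta>"] by simp

lemma word_action_uminus: "word_action I c xs (\<lambda>k. - \<beta> k) = (\<lambda>k. - word_action I c xs \<beta> k)"
  using word_action_scale[of I c xs "-1" \<beta>] by simp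

lemma word_action_diff_scale:
  "word_action I c xs (\<lambda>k. \<beta> k - m * \<gamma> k)
     = (\<lambda>k. word_action I c xs \<beta> k - m * word_action I c xs \<gamma> k)"
  using word_action_sum[where A = UNIV and f = "\<lambda>b. if b then 1 else - m"
      and g = "\<lambda>b. if b then \<beta> else \<gamma>"]
  by (simp add: UNIV_bool add.commute)

lemma word_action_cong:
  assumes "\<And>k. k \<in> I \<Longrightarrow> \<beta> k = \<gamma> k" "k \<in> I"
  shows "word_action I c xs \<beta> k = word_action I c xs \<gamma> k"
  using assms(2)
proof (induction xs arbitrary: k)
  case (Cons x xs)
  then have "pairing I c x (word_action I c xs \<beta>) = pairing I c x (word_action I c xs \<gamma>)"
    by (simp add: pairing_def)
  with Cons show ?case by (simp add: reflection_eq)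
qed (use assms in auto)

text \<open>Only coordinates in \<open>I\<close> can be expanded: outside \<open>I\<close> the
  action keeps \<beta>, while simple roots indexed by \<open>I\<close> vanish there.\<close>

lemma word_action_expand:
  assumes "finite I" "k \<in> I"
  shows "word_action I c xs \<beta> k = (\<Sum>i\<in>I. \<beta> i * word_action I c xs (simple_root i) k)"
proof -
  have "\<beta> j = (\<Sum>i\<in>I. \<beta> i * simple_root i j)" if "j \<in> I" for j
  proof -
    have "(\<Sum>i\<in>I. \<beta> i * simple_root i j) = (\<Sum>i\<in>I. if i = j then \<beta> i else 0)"
      by (rule sum.cong) (auto simp: simple_root_def)
    then show ?thesis using assms that by simp
  qed
  then have "word_action I c xs \<beta> k = word_action I c xs (\<lambda>j. \<Sum>i\<in>I. \<beta> i * simple_root i j) k"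
    using assms(2) by (rule word_action_cong)
  then show ?thesis by (simp add: word_action_sum)
qed

lemma weyl_groupI: "set xs \<subseteq> I \<Longrightarrow> word_action I c xs \<in> weyl_group I c"
  by (auto simp: weyl_group_def)

lemma weyl_groupE:
  assumes "w \<in> weyl_group I c"
  obtains xs where "set xs \<subseteq> I" "w = word_action I c xs"
  using assms by (auto simp: weyl_group_def lists_eq_set)

lemma rootsI: "set xs \<subseteq> I \<Longrightarrow> i \<in> I \<Longrightarrow> word_action I c xs (simple_root i) \<in> roots I c"
  unfolding roots_def using weyl_groupI by blast

lemma rootsE:
  assumes "\<beta> \<in> roots I c"
  obtains xs i where "set xs \<subseteq> I" "i \<in> I" "\<beta> = word_action I c xs (simple_root i)"
  using assms by (auto simp: roots_def elim!: weyl_groupE)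

lemma simple_root_in_roots: "i \<in> I \<Longrightarrow> simple_root i \<in> roots I c"
  using rootsI[of "[]" I i c] by simp

lemma word_action_roots:
  assumes "set xs \<subseteq> I" "\<beta> \<in> roots I c"
  shows "word_action I c xs \<beta> \<in> roots I c"
proof -
  obtain ys i where "set ys \<subseteq> I" "i \<in> I" "\<beta> = word_action I c ys (simple_root i)"
    using assms(2) by (rule rootsE)
  then show ?thesis
    using rootsI[of "xs @ ys" I i c] assms(1) by (simp add: word_action_append)
qed

lemma roots_outside: "\<beta> \<in> roots I c \<Longrightarrow> k \<notin> I \<Longrightarrow> \<beta> k = 0"
  by (elim rootsE) (auto simp: word_action_outside simple_root_def)

text \<open>The symmetriser is an explicit integer parameter, because it is known in both instances:
  constantly 1 on \<triangle>, and the orbit size on the folding. Positivity is required on lattice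
  vectors only, the only ones that occur.\<close>

locale cartan_form =
  fixes I :: "'a set" and c :: "'a \<Rightarrow> 'a \<Rightarrow> int" and d :: "'a \<Rightarrow> int"
  assumes finite_I: "finite I"
    and c_diag: "i \<in> I \<Longrightarrow> c i i = 2"
    and c_nonpos: "i \<in> I \<Longrightarrow> j \<in> I \<Longrightarrow> i \<noteq> j \<Longrightarrow> c i j \<le> 0"
    and d_pos: "i \<in> I \<Longrightarrow> 0 < d i"
    and d_sym: "i \<in> I \<Longrightarrow> j \<in> I \<Longrightarrow> d i * c i j = d j * c j i"
    and form_pos: "\<exists>i\<in>I. x i \<noteq> 0 \<Longrightarrow> 0 < (\<Sum>i\<in>I. \<Sum>j\<in>I. d i * c i j * x i * x j)"
begin

definition form :: "('a \<Rightarrow> int) \<Rightarrow> ('a \<Rightarrow> int) \<Rightarrow> int" where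
  "form \<beta> \<gamma> = (\<Sum>i\<in>I. \<Sum>j\<in>I. d i * c i j * \<beta> i * \<gamma> j)"

lemma form_eq_pairing: "form \<beta> \<gamma> = (\<Sum>i\<in>I. d i * \<beta> i * pairing I c i \<gamma>)"
  unfolding form_def pairing_def by (simp add: sum_distrib_left mult_ac)

lemma form_commute: "form \<beta> \<gamma> = form \<gamma> \<beta>"
proof -
  have "form \<beta> \<gamma> = (\<Sum>i\<in>I. \<Sum>j\<in>I. d j * c j i * \<beta> i * \<gamma> j)"
    unfolding form_def by (intro sum.cong refl) (simp add: d_sym)
  also have "\<dots> = (\<Sum>j\<in>I. \<Sum>i\<in>I. d j * c j i * \<beta> i * \<gamma> j)" by (rule sum.swap)
  finally show ?thesis by (simp add: form_def mult_ac)
qed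

lemma form_simple_root_left:
  assumes "i \<in> I"
  shows "form (simple_root i) \<beta> = d i * pairing I c i \<beta>"
proof -
  have "form (simple_root i) \<beta> = (\<Sum>k\<in>I. if k = i then d i * pairing I c i \<beta> else 0)"
    unfolding form_eq_pairing by (rule sum.cong) (auto simp: simple_root_def)
  then show ?thesis using assms finite_I by simp
qed

lemma form_diff_scale_left: "form (\<lambda>k. \<beta> k - m * \<beta>' k) \<gamma> = form \<beta> \<gamma> - m * form \<beta>' \<gamma>"
  by (simp add: form_eq_pairing algebra_simps sum_subtractf sum_distrib_left)

lemma form_diff_scale_right: "form \<beta> (\<lambda>k. \<gamma> k - m * \<gamma>' k) = form \<beta> \<gamma> - m * form \<beta> \<gamma>'"
  using form_diff_scale_left form_commute by metis

lemma form_simple_root_self: "i \<in> I \<Longrightarrow> form (simple_root i) (simple_root i) = 2 * d i"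
  by (simp add: form_simple_root_left finite_I c_diag)

lemma form_reflection:
  assumes "i \<in> I"
  shows "form (reflection I c i \<beta>) (reflection I c i \<gamma>) = form \<beta> \<gamma>"
  unfolding reflection_eq form_diff_scale_left form_diff_scale_right
  using assms form_commute[of \<beta> "simple_root i"]
  by (simp add: form_simple_root_self form_simple_root_left)
    (simp add: form_simple_root_left finite_I c_diag algebra_simps)

lemma form_word_action:
  "set xs \<subseteq> I \<Longrightarrow> form (word_action I c xs \<beta>) (word_action I c xs \<gamma>) = form \<beta> \<gamma>"
  by (induction xs) (auto simp: form_reflection)

lemma reflection_simple_root:
  "i \<in> I \<Longrightarrow> reflection I c i (simple_root i) = (\<lambda>k. - simple_root i k)"
  by (auto simp: reflection_eq finite_I c_diag)

lemma reflection_involution: "i \<in> I \<Longrightarrow> reflection I c i (reflection I c i \<beta>) = \<beta>"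
proof -
  assume i: "i \<in> I"
  have "reflection I c i (reflection I c i \<beta>)
    = reflection I c i (\<lambda>k. \<beta> k - pairing I c i \<beta> * simple_root i k)"
    by (simp add: reflection_eq[of I c i \<beta>])
  also have "\<dots> = (\<lambda>k. reflection I c i \<beta> k - pairing I c i \<beta> * reflection I c i (simple_root i) k)"
    using word_action_diff_scale[of I c "[i]" \<beta>] by simp
  also have "\<dots> = (\<lambda>k. reflection I c i \<beta> k + pairing I c i \<beta> * simple_root i k)"
    using i by (simp add: reflection_simple_root)
  finally show ?thesis by (simp add: reflection_eq[of I c i \<beta>])
qed

lemma word_action_rev: "set xs \<subseteq> I \<Longrightarrow> word_action I c (rev xs) (word_action I c xs \<beta>) = \<beta>"
  by (induction xs) (auto simp: word_action_append reflection_involution)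

lemma inj_word_action: "set xs \<subseteq> I \<Longrightarrow> inj (word_action I c xs)"
  by (metis injI word_action_rev)

lemma root_neq_0: "\<beta> \<in> roots I c \<Longrightarrow> \<beta> \<noteq> (\<lambda>_. 0)"
proof (elim rootsE, rule notI)
  fix xs i assume *: "set xs \<subseteq> I" "i \<in> I" "\<beta> = word_action I c xs (simple_root i)" "\<beta> = (\<lambda>_. 0)"
  have "form (simple_root i) (simple_root i) = form \<beta> \<beta>"
    using * by (simp add: form_word_action)
  also have "\<dots> = 0" using *(4) by (simp add: form_def)
  finally show False using * d_pos[of i] by (simp add: form_simple_root_self)
qed

text \<open>The inverse word turns the multiple into a simple root, whose coordinate 1 is then
  divisible by \<open>m\<close>.\<close>

lemma root_primitive:
  assumes "(\<lambda>k. m * \<gamma> k) \<in> roots I c"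
  shows "\<bar>m\<bar> = 1"
proof -
  obtain xs i where xs: "set xs \<subseteq> I" "i \<in> I" "(\<lambda>k. m * \<gamma> k) = word_action I c xs (simple_root i)"
    using assms by (rule rootsE)
  then have "simple_root i = word_action I c (rev xs) (\<lambda>k. m * \<gamma> k)"
    by (simp add: word_action_rev)
  then have "1 = m * word_action I c (rev xs) \<gamma> i"
    by (metis simple_root_simps(1) word_action_scale)
  then show ?thesis
    by (metis abs_zmult_eq_1 abs_one)
qed

text \<open>Root norms are among the \<open>2 * d i\<close>, so nonnegativity of the norm of \<beta>
  - \<alpha>_i and of \<beta> + \<alpha>_i bounds (\<alpha>_i, \<beta>) by \<open>K\<close>.
  Definiteness makes a root determined by these bounded integers.\<close>

lemma finite_roots: "finite (roots I c)"
proof -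
  define K where "K = (\<Sum>i\<in>I. 2 * d i)"
  have dK: "2 * d i \<le> K" if "i \<in> I" for i
    unfolding K_def using finite_I d_pos that by (intro member_le_sum) (auto simp: less_imp_le)
  have nonneg: "0 \<le> form x x" for x
  proof (cases "\<exists>i\<in>I. x i \<noteq> 0")
    case False then show ?thesis by (simp add: form_def)
  qed (use form_pos[of x] in \<open>simp add: form_def\<close>)
  have norm: "\<exists>i\<in>I. form \<beta> \<beta> = 2 * d i" if "\<beta> \<in> roots I c" for \<beta>
    using that by (elim rootsE) (auto simp: form_word_action form_simple_root_self)
  define f where "f = (\<lambda>\<beta>. restrict (\<lambda>i. form (simple_root i) \<beta>) I)"
  have bound: "form (simple_root i) \<beta> \<in> {-K..K}" if \<beta>: "\<beta> \<in> roots I c" and i: "i \<in> I" for \<beta> i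
  proof -
    have *: "0 \<le> form \<beta> \<beta> - m * form (simple_root i) \<beta> * 2 + m * m * (2 * d i)" for m
      using nonneg[of "\<lambda>k. \<beta> k - m * simple_root i k"] form_commute[of \<beta> "simple_root i"]
      unfolding form_diff_scale_left form_diff_scale_right
      by (simp add: form_simple_root_self[OF i] algebra_simps)
    obtain j where "j \<in> I" "form \<beta> \<beta> = 2 * d j" using norm[OF \<beta>] by blast
    then show ?thesis
      using *[of 1] *[of "-1"] dK[of j] dK[OF i] by simp
  qed
  have "f ` roots I c \<subseteq> I \<rightarrow>\<^sub>E {-K..K}"
    using bound by (auto simp: f_def)
  then have "finite (f ` roots I c)"
    using finite_PiE[OF finite_I, of "\<lambda>_. {-K..K}"] finite_subset by blast
  moreover have "inj_on f (roots I c)"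
  proof (rule inj_onI, rule ccontr)
    fix \<beta> \<gamma> assume *: "\<beta> \<in> roots I c" "\<gamma> \<in> roots I c" "f \<beta> = f \<gamma>" "\<beta> \<noteq> \<gamma>"
    define x where "x = (\<lambda>k. \<beta> k - 1 * \<gamma> k)"
    obtain k where "\<beta> k \<noteq> \<gamma> k" using *(4) by auto
    moreover from this have "k \<in> I" using *(1,2) roots_outside[of _ I c k] by metis
    ultimately have "\<exists>k\<in>I. x k \<noteq> 0" by (auto simp: x_def)
    then have "0 < form x x" unfolding form_def by (rule form_pos)
    have "form (simple_root i) x = 0" if "i \<in> I" for i
      using fun_cong[OF *(3), of i] that unfolding x_def form_diff_scale_right by (simp add: f_def)
    then have "pairing I c i x = 0" if "i \<in> I" for i
      using that form_simple_root_left[of i x] d_pos[of i] by simp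
    then have "form x x = 0" by (simp add: form_eq_pairing)
    with \<open>0 < form x x\<close> show False by simp
  qed
  ultimately show ?thesis by (rule finite_imageD)
qed

text \<open>The rule that w s_i w^-1 is the reflection in w \<alpha>_i. Invariance of the form first
  gives \<open>d a = d i\<close>; only then do equal form values yield equal pairings.\<close>

lemma word_action_conjugate:
  assumes ys: "set ys \<subseteq> I" and "i \<in> I" "a \<in> I"
    and eq: "word_action I c ys (simple_root i) = simple_root a"
  shows "word_action I c ys \<circ> reflection I c i = reflection I c a \<circ> word_action I c ys"
proof
  fix \<beta>
  let ?w = "word_action I c ys"
  have "2 * d a = form (?w (simple_root i)) (?w (simple_root i))"
    using assms by (simp only: eq form_simple_root_self)
  also have "\<dots> = 2 * d i" by (simp only: form_word_action[OF ys] form_simple_root_self[OF \<open>i \<in> I\<close>])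
  finally have d: "d a = d i" by simp
  have "d a * pairing I c a (?w \<beta>) = form (?w (simple_root i)) (?w \<beta>)"
    using \<open>a \<in> I\<close> by (simp only: eq form_simple_root_left)
  also have "\<dots> = d i * pairing I c i \<beta>"
    using ys \<open>i \<in> I\<close> by (simp only: form_word_action form_simple_root_left)
  finally have "pairing I c a (?w \<beta>) = pairing I c i \<beta>"
    using d d_pos[of a] \<open>a \<in> I\<close> by simp
  then show "(?w \<circ> reflection I c i) \<beta> = (reflection I c a \<circ> ?w) \<beta>"
    by (simp add: reflection_eq word_action_diff_scale eq)
qed

end

section \<open>Exchange, inversions and length\<close>

definition nonneg :: "('a \<Rightarrow> int) \<Rightarrow> bool" where
  "nonneg \<beta> \<longleftrightarrow> (\<forall>k. 0 \<le> \<beta> k)"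

lemma nonneg_simple_root: "nonneg (simple_root i)"
  by (simp add: nonneg_def simple_root_def)

text \<open>Coherence is an assumption since it has two different proofs: an evenness argument in
  the simply-laced case, and inheritance along the lift for the folding.\<close>

locale coherent_cartan = cartan_form +
  assumes coherent: "\<beta> \<in> roots I c \<Longrightarrow> nonneg \<beta> \<or> nonneg (\<lambda>k. - \<beta> k)"
begin

lemma not_both_signs: "\<beta> \<in> roots I c \<Longrightarrow> nonneg \<beta> \<Longrightarrow> \<not> nonneg (\<lambda>k. - \<beta> k)"
proof
  assume *: "\<beta> \<in> roots I c" "nonneg \<beta>" "nonneg (\<lambda>k. - \<beta> k)"
  then have "\<beta> = (\<lambda>_. 0)" by (auto simp: nonneg_def fun_eq_iff intro: order.antisym)
  with root_neq_0 * show False by blast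
qed

lemma not_nonneg: "\<beta> \<in> roots I c \<Longrightarrow> \<not> nonneg \<beta> \<longleftrightarrow> nonneg (\<lambda>k. - \<beta> k)"
  using not_both_signs coherent by blast

lemma roots_uminus: "\<beta> \<in> roots I c \<Longrightarrow> (\<lambda>k. - \<beta> k) \<in> roots I c"
proof (elim rootsE)
  fix xs i assume *: "set xs \<subseteq> I" "i \<in> I" "\<beta> = word_action I c xs (simple_root i)"
  then have "(\<lambda>k. - \<beta> k) = word_action I c (xs @ [i]) (simple_root i)"
    by (simp add: word_action_append reflection_simple_root word_action_uminus)
  then show "(\<lambda>k. - \<beta> k) \<in> roots I c" using * rootsI[of "xs @ [i]" I i c] by simp
qed

lemma reflection_roots: "i \<in> I \<Longrightarrow> \<beta> \<in> roots I c \<Longrightarrow> reflection I c i \<beta> \<in> roots I c"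
  using word_action_roots[of "[i]" I \<beta> c] by simp

text \<open>A simple reflection changes one coordinate only, so it can reverse the sign of a root only if
  the root is a multiple of the simple root.\<close>

lemma positive_root_reflected_negative:
  assumes "\<beta> \<in> roots I c" "nonneg \<beta>" "a \<in> I" "\<not> nonneg (reflection I c a \<beta>)"
  shows "\<beta> = simple_root a"
proof -
  have neg: "reflection I c a \<beta> k \<le> 0" for k
    using assms not_nonneg reflection_roots by (force simp: nonneg_def)
  have "\<beta> k = 0" if "k \<noteq> a" for k
    using neg[of k] that assms(2) by (simp add: reflection_eq nonneg_def order.antisym)
  then have eq: "\<beta> = (\<lambda>k. \<beta> a * simple_root a k)"
    by (auto simp: fun_eq_iff simple_root_def)
  then have "\<bar>\<beta> a\<bar> = 1" using root_primitive[of "\<beta> a" "simple_root a"] assms(1) by simp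
  moreover have "0 \<le> \<beta> a" using assms(2) by (simp add: nonneg_def)
  ultimately have "\<beta> a = 1" by linarith
  then show ?thesis using eq by simp
qed

text \<open>Applying the letters from the right, some letter \<open>a\<close> is the one that makes
  the image of \<alpha>_i negative. Just before, this image is \<alpha>_a, so s_i passes through the
  letters already applied, becomes s_a and cancels the letter.\<close>

lemma exchange:
  assumes "set ys \<subseteq> I" "i \<in> I" "\<not> nonneg (word_action I c ys (simple_root i))"
  shows "\<exists>zs. set zs \<subseteq> I \<and> length zs < length ys
    \<and> word_action I c ys \<circ> reflection I c i = word_action I c zs"
  using assms
proof (induction ys)
  case Nil then show ?case by (simp add: nonneg_simple_root)
next
  case (Cons a ys)
  show ?case
  proof (cases "nonneg (word_action I c ys (simple_root i))")
    case False
    with Cons obtain zs where "set zs \<subseteq> I" "length zs < length ys"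
      "word_action I c ys \<circ> reflection I c i = word_action I c zs"
      by (metis list.set_intros(2) subset_code(1))
    then show ?thesis using Cons.prems
      by (intro exI[of _ "a # zs"]) (simp add: comp_assoc del: o_apply)
  next
    case True
    then have "word_action I c ys (simple_root i) = simple_root a"
      using Cons.prems by (intro positive_root_reflected_negative) (auto intro: rootsI)
    then have eq: "word_action I c ys \<circ> reflection I c i = reflection I c a \<circ> word_action I c ys"
      using Cons.prems by (intro word_action_conjugate) auto
    have "word_action I c (a # ys) \<circ> reflection I c i = word_action I c ys"
    proof
      fix \<beta>
      show "(word_action I c (a # ys) \<circ> reflection I c i) \<beta> = word_action I c ys \<beta>"
        using fun_cong[OF eq, of \<beta>] Cons.prems by (simp add: reflection_involution)
    qed
    with Cons.prems show ?thesis by (metis length_Cons lessI list.set_intros(2) subset_code(1))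
  qed
qed

text \<open>If a nonempty word ends in \<open>i\<close>, its prefix sends \<alpha>_i to a negative
  root, and exchange produces a shorter word for the same element, which still satisfies the
  hypothesis.\<close>

lemma word_action_eq_id:
  assumes "set xs \<subseteq> I" "\<And>i. i \<in> I \<Longrightarrow> nonneg (word_action I c xs (simple_root i))"
  shows "word_action I c xs = id"
  using assms
proof (induction "length xs" arbitrary: xs rule: less_induct)
  case less
  show ?case
  proof (cases xs rule: rev_cases)
    case (snoc ys i)
    then have i: "i \<in> I" "set ys \<subseteq> I" using less.prems by auto
    have "word_action I c xs (simple_root i) = (\<lambda>k. - word_action I c ys (simple_root i) k)"
      using snoc i by (simp add: word_action_append reflection_simple_root word_action_uminus)
    then have "\<not> nonneg (word_action I c ys (simple_root i))"
      using less.prems(2)[OF i(1)] not_both_signs i rootsI by metis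
    then obtain zs where "set zs \<subseteq> I" "length zs < length ys"
      "word_action I c xs = word_action I c zs"
      using exchange[OF i(2,1)] snoc by (auto simp: word_action_append)
    then show ?thesis using less snoc by simp
  qed simp
qed

text \<open>Its cardinality will replace \<open>weyl_length\<close>, which as a minimum over words
  is hard to compare directly.\<close>

definition inversions :: "(('a \<Rightarrow> int) \<Rightarrow> ('a \<Rightarrow> int)) \<Rightarrow> ('a \<Rightarrow> int) set" where
  "inversions w = {\<beta> \<in> roots I c. nonneg \<beta> \<and> \<not> nonneg (w \<beta>)}"

lemma finite_inversions: "finite (inversions w)"
  using finite_roots by (rule rev_finite_subset) (auto simp: inversions_def)

text \<open>The reflection s_i permutes the positive roots other than \<alpha>_i. So it carries the
  inversions of w to those of w s_i, and \<alpha>_i itself is the one additional inversion.\<close>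

lemma inversions_reflection:
  assumes xs: "set xs \<subseteq> I" and i: "i \<in> I" and pos: "nonneg (word_action I c xs (simple_root i))"
  shows "card (inversions (word_action I c (xs @ [i]))) = Suc (card (inversions (word_action I c xs)))"
proof -
  let ?w = "word_action I c xs" and ?s = "reflection I c i"
  have wi: "word_action I c (xs @ [i]) = ?w \<circ> ?s" by (simp add: word_action_append)
  have neg: "\<not> nonneg (?w (\<lambda>k. - simple_root i k))"
    using pos not_both_signs[OF rootsI[OF xs i]] by (simp add: word_action_uminus)
  have pres: "nonneg (?s \<beta>)" if "\<beta> \<in> roots I c" "nonneg \<beta>" "\<beta> \<noteq> simple_root i" for \<beta>
    using positive_root_reflected_negative[of \<beta> i] that i by auto
  have s_root: "\<beta> = (\<lambda>k. - simple_root i k)" if "simple_root i = ?s \<beta>" for \<beta>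
    using reflection_involution[OF i, of \<beta>] that[symmetric] reflection_simple_root[OF i] by simp
  have neg_i: "\<not> nonneg (\<lambda>k. - simple_root i k)"
    by (simp add: nonneg_def exI[of _ i])
  have "inversions (?w \<circ> ?s) = insert (simple_root i) (?s ` inversions ?w)"
  proof (intro equalityI subsetI)
    fix \<beta> assume \<beta>: "\<beta> \<in> inversions (?w \<circ> ?s)"
    show "\<beta> \<in> insert (simple_root i) (?s ` inversions ?w)"
    proof (cases "\<beta> = simple_root i")
      case False
      then have "?s \<beta> \<in> inversions ?w"
        using \<beta> pres i by (auto simp: inversions_def reflection_roots)
      then show ?thesis using i by (metis image_eqI insertI2 reflection_involution)
    qed simp
  next
    fix \<beta> assume "\<beta> \<in> insert (simple_root i) (?s ` inversions ?w)"
    then show "\<beta> \<in> inversions (?w \<circ> ?s)"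
    proof (elim insertE imageE)
      assume "\<beta> = simple_root i"
      then show ?thesis
        using i neg by (simp add: inversions_def simple_root_in_roots nonneg_simple_root
            reflection_simple_root)
    next
      fix \<gamma> assume "\<beta> = ?s \<gamma>" "\<gamma> \<in> inversions ?w"
      moreover from this have "\<gamma> \<noteq> simple_root i" using pos by (auto simp: inversions_def)
      ultimately show ?thesis
        using i pres by (auto simp: inversions_def reflection_roots reflection_involution)
    qed
  qed
  moreover have "simple_root i \<notin> ?s ` inversions ?w"
    using s_root neg_i by (auto simp: inversions_def)
  moreover have "inj_on ?s (inversions ?w)"
    using i by (metis inj_onI reflection_involution)
  ultimately show ?thesis
    by (simp add: wi card_image finite_inversions)
qed

lemma inversions_reflection':
  assumes xs: "set xs \<subseteq> I" and i: "i \<in> I" and neg: "\<not> nonneg (word_action I c xs (simple_root i))"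
  shows "card (inversions (word_action I c xs)) = Suc (card (inversions (word_action I c (xs @ [i]))))"
proof -
  have "nonneg (word_action I c (xs @ [i]) (simple_root i))"
    using neg not_nonneg[OF rootsI[OF xs i]] i
    by (simp add: word_action_append reflection_simple_root word_action_uminus)
  moreover have "word_action I c ((xs @ [i]) @ [i]) = word_action I c xs"
    using i by (auto simp: word_action_append reflection_involution)
  ultimately show ?thesis using inversions_reflection[of "xs @ [i]" i] xs i by simp
qed

lemma inversions_id [simp]: "inversions id = {}" "inversions (\<lambda>\<beta>. \<beta>) = {}"
  by (simp_all add: inversions_def)

lemma inversions_le_length: "set xs \<subseteq> I \<Longrightarrow> card (inversions (word_action I c xs)) \<le> length xs"
proof (induction xs rule: rev_induct)
  case Nil
  show ?case by simp
next
  case (snoc i xs)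
  then show ?case
    using inversions_reflection[of xs i] inversions_reflection'[of xs i]
    by (cases "nonneg (word_action I c xs (simple_root i))") auto
qed

text \<open>With no inversions the element is trivial. Otherwise some simple root becomes negative,
  and appending its reflection removes exactly one inversion.\<close>

lemma ex_word_of_length_inversions:
  "set xs \<subseteq> I \<Longrightarrow> \<exists>ys. set ys \<subseteq> I \<and> length ys = card (inversions (word_action I c xs))
     \<and> word_action I c ys = word_action I c xs"
proof (induction "card (inversions (word_action I c xs))" arbitrary: xs)
  case 0
  then have "inversions (word_action I c xs) = {}" using finite_inversions by auto
  then have "nonneg (word_action I c xs (simple_root i))" if "i \<in> I" for i
    using that nonneg_simple_root[of i] simple_root_in_roots[of i I c]
    unfolding inversions_def by blast
  then have "word_action I c xs = id" using 0 by (intro word_action_eq_id)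
  then show ?case by (intro exI[of _ "[]"]) simp
next
  case (Suc n)
  have "word_action I c xs \<noteq> id"
  proof
    assume "word_action I c xs = id"
    with Suc.hyps(2) show False by simp
  qed
  then obtain i where i: "i \<in> I" "\<not> nonneg (word_action I c xs (simple_root i))"
    using word_action_eq_id[OF Suc.prems] by blast
  then have n: "n = card (inversions (word_action I c (xs @ [i])))"
    using inversions_reflection'[OF Suc.prems i] Suc.hyps(2) by simp
  then obtain ys where ys: "set ys \<subseteq> I" "length ys = n"
    "word_action I c ys = word_action I c (xs @ [i])"
    using Suc.hyps(1)[OF n] Suc.prems i by auto
  then have "word_action I c (ys @ [i]) = word_action I c xs"
    using i by (auto simp: word_action_append reflection_involution)
  then show ?case using ys i Suc.hyps(2) by (intro exI[of _ "ys @ [i]"]) auto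
qed

lemma weyl_length_eq:
  "set xs \<subseteq> I \<Longrightarrow> weyl_length I c (word_action I c xs) = card (inversions (word_action I c xs))"
  unfolding weyl_length_def
proof (rule Least_equality)
  assume "set xs \<subseteq> I"
  then obtain ys where "set ys \<subseteq> I" "length ys = card (inversions (word_action I c xs))"
    "word_action I c ys = word_action I c xs"
    using ex_word_of_length_inversions by blast
  then show "\<exists>ys\<in>lists I. length ys = card (inversions (word_action I c xs))
      \<and> word_action I c ys = word_action I c xs"
    by (intro bexI[of _ ys]) (auto simp del: word_action_Cons)
next
  fix n assume "\<exists>ys\<in>lists I. length ys = n \<and> word_action I c ys = word_action I c xs"
  then obtain ys where "set ys \<subseteq> I" "length ys = n" "word_action I c ys = word_action I c xs"
    by (auto simp only: in_lists_conv_set)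
  then show "card (inversions (word_action I c xs)) \<le> n" using inversions_le_length[of ys] by simp
qed

section \<open>The longest element and its involution\<close>

text \<open>A characterisation of w_0 that, unlike maximal length, can be checked for a lifted
  word.\<close>

definition negates :: "(('a \<Rightarrow> int) \<Rightarrow> ('a \<Rightarrow> int)) \<Rightarrow> bool" where
  "negates w \<longleftrightarrow> (\<forall>i\<in>I. nonneg (\<lambda>k. - w (simple_root i) k))"

lemma negates_nonneg:
  assumes "set xs \<subseteq> I" "negates (word_action I c xs)" "nonneg \<beta>" "\<And>k. k \<notin> I \<Longrightarrow> \<beta> k = 0"
  shows "nonneg (\<lambda>k. - word_action I c xs \<beta> k)"
  unfolding nonneg_def
proof
  fix k
  show "0 \<le> - word_action I c xs \<beta> k"
  proof (cases "k \<in> I")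
    case True
    have "(\<Sum>i\<in>I. \<beta> i * word_action I c xs (simple_root i) k) \<le> 0"
      using assms(2,3) by (intro sum_nonpos mult_nonneg_nonpos) (auto simp: negates_def nonneg_def)
    then show ?thesis using word_action_expand[OF finite_I True, of c xs \<beta>] by simp
  qed (use assms in \<open>simp add: word_action_outside\<close>)
qed

text \<open>If some \<alpha>_i stayed positive, appending \<open>i\<close> would add an inversion
  and so lengthen the element.\<close>

lemma maximal_length_imp_negates:
  assumes xs: "set xs \<subseteq> I"
    and max: "\<forall>v\<in>weyl_group I c. weyl_length I c v \<le> weyl_length I c (word_action I c xs)"
  shows "negates (word_action I c xs)"
  unfolding negates_def
proof (intro ballI, rule ccontr)
  fix i assume i: "i \<in> I" "\<not> nonneg (\<lambda>k. - word_action I c xs (simple_root i) k)"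
  then have "nonneg (word_action I c xs (simple_root i))"
    using not_nonneg[OF rootsI[OF xs i(1)]] by blast
  then have "weyl_length I c (word_action I c (xs @ [i])) > weyl_length I c (word_action I c xs)"
    using i xs inversions_reflection[of xs i] weyl_length_eq[of xs] weyl_length_eq[of "xs @ [i]"]
    by simp
  moreover have "word_action I c (xs @ [i]) \<in> weyl_group I c"
    using i xs by (intro weyl_groupI) auto
  ultimately show False using max by fastforce
qed

text \<open>Two sign reversals in succession keep every simple root positive, so the product is
  trivial. With \<open>xs = ys\<close> this says that w_0 is an involution.\<close>

lemma negates_inverse:
  assumes xs: "set xs \<subseteq> I" "negates (word_action I c xs)"
    and ys: "set ys \<subseteq> I" "negates (word_action I c ys)"
  shows "word_action I c ys (word_action I c xs \<beta>) = \<beta>"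
proof -
  have "word_action I c (ys @ xs) = id"
  proof (rule word_action_eq_id)
    fix i assume i: "i \<in> I"
    let ?\<gamma> = "\<lambda>k. - word_action I c xs (simple_root i) k"
    have "nonneg ?\<gamma>" using xs i by (auto simp: negates_def)
    moreover have "?\<gamma> k = 0" if "k \<notin> I" for k
      using that i xs(1) by (auto simp: word_action_outside simple_root_def)
    ultimately have "nonneg (\<lambda>k. - word_action I c ys ?\<gamma> k)"
      using negates_nonneg[OF ys] by simp
    then show "nonneg (word_action I c (ys @ xs) (simple_root i))"
      by (simp add: word_action_append word_action_uminus)
  qed (use xs ys in auto)
  then show ?thesis by (simp add: word_action_append fun_eq_iff)
qed

lemma negates_unique:
  assumes "set xs \<subseteq> I" "negates (word_action I c xs)" "set ys \<subseteq> I" "negates (word_action I c ys)"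
  shows "word_action I c xs = word_action I c ys"
proof
  fix \<beta>
  have "word_action I c ys (word_action I c xs \<beta>) = word_action I c ys (word_action I c ys \<beta>)"
    by (simp only: negates_inverse[OF assms] negates_inverse[OF assms(3,4) assms(3,4)])
  then show "word_action I c xs \<beta> = word_action I c ys \<beta>"
    using inj_word_action[OF assms(3)] by (simp add: inj_eq)
qed

lemma longest_element_exists:
  "\<exists>xs. set xs \<subseteq> I \<and> (\<forall>v\<in>weyl_group I c. weyl_length I c v \<le> weyl_length I c (word_action I c xs))"
proof -
  have "weyl_length I c v \<le> card (roots I c)" if "v \<in> weyl_group I c" for v
  proof -
    obtain xs where "set xs \<subseteq> I" "v = word_action I c xs" using \<open>v \<in> weyl_group I c\<close> by (rule weyl_groupE)
    moreover have "card (inversions v) \<le> card (roots I c)"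
      using finite_roots by (intro card_mono) (auto simp: inversions_def)
    ultimately show ?thesis by (simp add: weyl_length_eq)
  qed
  moreover have "id \<in> weyl_group I c" using weyl_groupI[of "[]" I c] by simp
  ultimately obtain w where "w \<in> weyl_group I c"
    "\<forall>v\<in>weyl_group I c. weyl_length I c v \<le> weyl_length I c w"
    using ex_has_greatest_nat[of "\<lambda>w. w \<in> weyl_group I c" id "weyl_length I c"
        "Suc (card (roots I c))"]
    by (auto simp: less_Suc_eq_le)
  moreover obtain xs where "set xs \<subseteq> I" "w = word_action I c xs"
    using \<open>w \<in> weyl_group I c\<close> by (rule weyl_groupE)
  ultimately show ?thesis by blast
qed

text \<open>Justifies the definite description: an element of maximal length exists because
  inversions are roots, and it is unique because it negates all simple roots.\<close>

lemma longest_element: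
  obtains xs where "set xs \<subseteq> I" "longest_element I c = word_action I c xs"
    "negates (word_action I c xs)"
proof -
  obtain xs where xs: "set xs \<subseteq> I"
    "\<forall>v\<in>weyl_group I c. weyl_length I c v \<le> weyl_length I c (word_action I c xs)"
    using longest_element_exists by blast
  have neg: "negates (word_action I c xs)" using xs by (rule maximal_length_imp_negates)
  have "longest_element I c = word_action I c xs"
    unfolding longest_element_def
  proof (rule the_equality)
    fix w assume w: "w \<in> weyl_group I c \<and> (\<forall>v\<in>weyl_group I c. weyl_length I c v \<le> weyl_length I c w)"
    then obtain ys where "set ys \<subseteq> I" "w = word_action I c ys" by (auto elim: weyl_groupE)
    then show "w = word_action I c xs"
      using maximal_length_imp_negates[of ys] w negates_unique[of ys xs] xs(1) neg by simp
  qed (use xs weyl_groupI in blast)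
  then show ?thesis using that xs neg by blast
qed

text \<open>The heights of the \<open>- w\<^sub>0 \<alpha>\<^sub>j\<close> are at least \<open>1\<close>, and \<open>- w\<^sub>0\<close> is an involution; comparing
  heights in the expansion of \<open>\<alpha>\<^sub>i\<close> forces \<open>- w\<^sub>0 \<alpha>\<^sub>i\<close> to be simple.\<close>

lemma negates_simple_root:
  assumes xs: "set xs \<subseteq> I" "negates (word_action I c xs)" and i: "i \<in> I"
  shows "\<exists>j\<in>I. word_action I c xs (simple_root i) = (\<lambda>k. - simple_root j k)"
proof -
  define \<phi> where "\<phi> i = (\<lambda>k. - word_action I c xs (simple_root i) k)" for i
  define ht where "ht \<beta> = (\<Sum>k\<in>I. \<beta> k)" for \<beta> :: "'a \<Rightarrow> int"
  have out: "\<phi> j k = 0" if "j \<in> I" "k \<notin> I" for j k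
    using that xs by (auto simp: \<phi>_def word_action_outside simple_root_def)
  have root: "\<phi> j \<in> roots I c" if "j \<in> I" for j
    unfolding \<phi>_def using that xs by (intro roots_uminus rootsI)
  have nn: "nonneg (\<phi> j)" if "j \<in> I" for j
    using that xs by (auto simp: \<phi>_def negates_def)
  have ht: "1 \<le> ht (\<phi> j)" if j: "j \<in> I" for j
  proof -
    obtain k where k: "\<phi> j k \<noteq> 0" using root_neq_0[OF root[OF j]] by auto
    then have "k \<in> I" using out j by blast
    then have "\<phi> j k \<le> ht (\<phi> j)"
      unfolding ht_def using nn[OF j] finite_I by (intro member_le_sum) (auto simp: nonneg_def)
    moreover have "0 \<le> \<phi> j k" using nn[OF j] by (simp add: nonneg_def)
    ultimately show ?thesis using k by linarith
  qed
  have expand: "simple_root i k = (\<Sum>j\<in>I. \<phi> i j * \<phi> j k)" if "k \<in> I" for k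
  proof -
    have "simple_root i k = word_action I c xs (word_action I c xs (simple_root i)) k"
      using negates_inverse xs by simp
    also have "\<dots> = (\<Sum>j\<in>I. \<phi> i j * \<phi> j k)"
      unfolding word_action_expand[OF finite_I that, of c xs "word_action I c xs (simple_root i)"]
      by (simp add: \<phi>_def)
    finally show ?thesis .
  qed
  have "1 = ht (simple_root i)"
    using i finite_I by (simp add: ht_def simple_root_def)
  also have "\<dots> = (\<Sum>k\<in>I. \<Sum>j\<in>I. \<phi> i j * \<phi> j k)" by (simp add: ht_def expand)
  also have "\<dots> = (\<Sum>j\<in>I. \<phi> i j * ht (\<phi> j))"
    unfolding ht_def sum_distrib_left by (rule sum.swap)
  also have "\<dots> \<ge> (\<Sum>j\<in>I. \<phi> i j * 1)"
    using nn[OF i] ht by (intro sum_mono mult_left_mono) (auto simp: nonneg_def)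
  finally have "ht (\<phi> i) \<le> 1" by (simp add: ht_def)
  with ht[OF i] have ht1: "ht (\<phi> i) = 1" by simp
  then obtain j where j: "j \<in> I" "\<phi> i j \<noteq> 0" unfolding ht_def by (metis sum.neutral zero_neq_one)
  moreover have "0 \<le> \<phi> i j" using nn[OF i] by (simp add: nonneg_def)
  ultimately have j1: "1 \<le> \<phi> i j" by linarith
  have "ht (\<phi> i) = \<phi> i j + (\<Sum>k\<in>I - {j}. \<phi> i k)"
    unfolding ht_def using j finite_I by (rule_tac sum.remove) auto
  moreover have "0 \<le> (\<Sum>k\<in>I - {j}. \<phi> i k)"
    using nn[OF i] by (intro sum_nonneg) (simp add: nonneg_def)
  ultimately have "\<phi> i j = 1" and z: "(\<Sum>k\<in>I - {j}. \<phi> i k) = 0" using ht1 j1 by auto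
  moreover have "\<phi> i k = 0" if "k \<noteq> j" for k
  proof (cases "k \<in> I")
    case True
    have "\<forall>k\<in>I - {j}. \<phi> i k = 0"
      using z nn[OF i] finite_I by (subst (asm) sum_nonneg_eq_0_iff) (auto simp: nonneg_def)
    then show ?thesis using True that by simp
  qed (use out i in simp)
  ultimately have "\<phi> i = simple_root j" by (auto simp: simple_root_def)
  then have "word_action I c xs (simple_root i) = (\<lambda>k. - simple_root j k)"
    by (auto simp: \<phi>_def fun_eq_iff) (metis add.inverse_inverse)
  then show ?thesis using j by blast
qed

lemma dynkin_star_eqI:
  assumes "j \<in> I" "longest_element I c (simple_root i) = (\<lambda>k. - simple_root j k)"
  shows "dynkin_star I c i = j"
  unfolding dynkin_star_def
proof (rule the_equality)
  fix j' assume "j' \<in> I \<and> longest_element I c (simple_root i) = (\<lambda>k. - simple_root j' k)"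
  then have "(- simple_root j' j' :: int) = - simple_root j j'" using assms(2) by metis
  then show "j' = j" by (auto simp: simple_root_def split: if_splits)
qed (use assms in blast)

lemma dynkin_star:
  assumes "i \<in> I"
  shows "dynkin_star I c i \<in> I"
    and "longest_element I c (simple_root i) = (\<lambda>k. - simple_root (dynkin_star I c i) k)"
proof -
  obtain j where "j \<in> I" "longest_element I c (simple_root i) = (\<lambda>k. - simple_root j k)"
  proof (rule longest_element)
    fix xs assume "set xs \<subseteq> I" "longest_element I c = word_action I c xs"
      "negates (word_action I c xs)"
    then show thesis using negates_simple_root[of xs i] assms that by auto
  qed
  then show "dynkin_star I c i \<in> I"
    "longest_element I c (simple_root i) = (\<lambda>k. - simple_root (dynkin_star I c i) k)"
    using dynkin_star_eqI by auto
qed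

lemma simple_root_inject: "simple_root i = simple_root j \<longleftrightarrow> i = j"
  by (auto simp: simple_root_def fun_eq_iff)

lemma inj_on_dynkin_star: "inj_on (dynkin_star I c) I"
proof (rule inj_onI)
  fix i j assume ij: "i \<in> I" "j \<in> I" "dynkin_star I c i = dynkin_star I c j"
  obtain xs where xs: "set xs \<subseteq> I" "longest_element I c = word_action I c xs"
    by (rule longest_element)
  have "word_action I c xs (simple_root i) = word_action I c xs (simple_root j)"
    using dynkin_star(2)[OF ij(1)] dynkin_star(2)[OF ij(2)] ij(3) xs by simp
  then have "simple_root i = simple_root j" using inj_word_action[OF xs(1)] by (simp add: inj_eq)
  then show "i = j" by (simp add: simple_root_inject)
qed

end

subsection \<open>Coxeter elements of a forest are conjugate\<close>

text \<open>A swap leaves the product of reflections unchanged and a rotation conjugates it by a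
  reflection, so equivalent words have the same trivial powers. Keeping the relation on words makes
  the rest pure graph theory.\<close>

inductive cox_equiv :: "('a \<Rightarrow> 'a \<Rightarrow> int) \<Rightarrow> 'a list \<Rightarrow> 'a list \<Rightarrow> bool" for c where
  cox_swap: "\<not> adjacent c a b \<Longrightarrow> cox_equiv c (xs @ a # b # ys) (xs @ b # a # ys)"
| cox_rotate: "cox_equiv c (a # xs) (xs @ [a])"
| cox_refl: "cox_equiv c xs xs"
| cox_sym: "cox_equiv c xs ys \<Longrightarrow> cox_equiv c ys xs"
| cox_trans: "cox_equiv c xs ys \<Longrightarrow> cox_equiv c ys zs \<Longrightarrow> cox_equiv c xs zs"

lemma cox_equiv_mset: "cox_equiv c xs ys \<Longrightarrow> mset xs = mset ys"
  by (induction rule: cox_equiv.induct) auto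

lemma cox_equiv_set: "cox_equiv c xs ys \<Longrightarrow> set xs = set ys"
  by (metis cox_equiv_mset set_mset_mset)

lemma cox_equiv_distinct: "cox_equiv c xs ys \<Longrightarrow> distinct xs \<longleftrightarrow> distinct ys"
  using cox_equiv_mset mset_eq_imp_distinct_iff by blast

lemma cox_equiv_move:
  "\<forall>b\<in>set p. \<not> adjacent c b v \<Longrightarrow> cox_equiv c (r @ p @ v # q) (r @ v # p @ q)"
proof (induction p arbitrary: q rule: rev_induct)
  case Nil show ?case by (simp add: cox_equiv.cox_refl)
next
  case (snoc b p)
  have "cox_equiv c ((r @ p) @ b # v # q) ((r @ p) @ v # b # q)"
    using snoc.prems by (intro cox_equiv.cox_swap) simp
  moreover have "cox_equiv c (r @ p @ v # b # q) (r @ v # p @ b # q)"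
    using snoc by simp
  ultimately show ?case by (auto intro: cox_equiv.cox_trans)
qed

lemma funpow_comp_commute: "(f \<circ> g) ^^ n \<circ> f = f \<circ> (g \<circ> f) ^^ n"
proof (induction n)
  case (Suc n)
  have "(f \<circ> g) ^^ Suc n \<circ> f = (f \<circ> g) \<circ> ((f \<circ> g) ^^ n \<circ> f)" by (simp only: funpow.simps comp_assoc)
  also have "\<dots> = f \<circ> (g \<circ> f) ^^ Suc n" by (simp only: Suc funpow.simps comp_assoc)
  finally show ?case .
qed simp

text \<open>For an involution \<open>f\<close>, conjugation by \<open>f\<close> exchanges the two
  compositions. This is the rotation case for Coxeter words.\<close>

lemma funpow_comp_involution:
  assumes "f \<circ> f = id"
  shows "(f \<circ> g) ^^ n = id \<longleftrightarrow> (g \<circ> f) ^^ n = id"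
proof
  assume "(f \<circ> g) ^^ n = id"
  then have "f \<circ> (f \<circ> (g \<circ> f) ^^ n) = f \<circ> f"
    using funpow_comp_commute[of n f g] by (simp only: id_comp)
  then show "(g \<circ> f) ^^ n = id" by (simp only: comp_assoc[symmetric] assms id_comp)
next
  assume "(g \<circ> f) ^^ n = id"
  then have "((f \<circ> g) ^^ n \<circ> f) \<circ> f = f \<circ> f"
    using funpow_comp_commute[of n f g] by (simp only: comp_id)
  then show "(f \<circ> g) ^^ n = id" by (simp only: comp_assoc assms comp_id)
qed

context cartan_form
begin

lemma c_eq_0_sym: "i \<in> I \<Longrightarrow> j \<in> I \<Longrightarrow> c i j = 0 \<longleftrightarrow> c j i = 0"
  using d_sym[of i j] d_pos[of i] d_pos[of j] by (metis less_irrefl mult_eq_0_iff)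

lemma adjacent_sym: "i \<in> I \<Longrightarrow> j \<in> I \<Longrightarrow> adjacent c i j \<longleftrightarrow> adjacent c j i"
  by (auto simp: adjacent_def c_eq_0_sym)

text \<open>If every vertex of \<open>J\<close> had two neighbours in \<open>J\<close>, the form would be nonpositive on the
  indicator function of \<open>J\<close>.\<close>

lemma exists_leaf:
  assumes "J \<subseteq> I" "J \<noteq> {}"
  shows "\<exists>v\<in>J. \<forall>u\<in>J. \<forall>u'\<in>J. adjacent c v u \<longrightarrow> adjacent c v u' \<longrightarrow> u = u'"
proof (rule ccontr)
  assume "\<not> ?thesis"
  then have two: "\<exists>u\<in>J. \<exists>u'\<in>J. adjacent c v u \<and> adjacent c v u' \<and> u \<noteq> u'" if "v \<in> J" for v
    using that by blast
  have fin: "finite J" using assms finite_I finite_subset by blast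
  define x where "x i = (if i \<in> J then 1 else 0 :: int)" for i
  have "(\<Sum>i\<in>I. \<Sum>j\<in>I. d i * c i j * x i * x j) = (\<Sum>i\<in>J. \<Sum>j\<in>J. d i * c i j * x i * x j)"
    using assms finite_I by (intro sum.mono_neutral_cong_right) (auto simp: x_def intro!: sum.mono_neutral_right)
  also have "\<dots> = (\<Sum>i\<in>J. d i * (\<Sum>j\<in>J. c i j))"
    by (simp add: x_def sum_distrib_left)
  also have "\<dots> \<le> 0"
  proof (rule sum_nonpos, rule mult_nonneg_nonpos)
    fix v assume v: "v \<in> J"
    show "0 \<le> d v" using d_pos v assms by (simp add: less_imp_le subset_iff)
    obtain u u' where u: "u \<in> J" "u' \<in> J" "adjacent c v u" "adjacent c v u'" "u \<noteq> u'"
      using two v by blast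
    have neg: "c v j \<le> -1" if "j \<in> J" "adjacent c v j" for j
    proof -
      have "c v j \<le> 0" "c v j \<noteq> 0"
        using that v assms(1) c_nonpos[of v j] by (auto simp: adjacent_def)
      then show ?thesis by linarith
    qed
    \<comment> \<open>The diagonal entry 2 is absorbed by the two neighbours, each contributing at
      most -1; the rest of the row is nonpositive.\<close>
    have "(\<Sum>j\<in>J. c v j) = (\<Sum>j\<in>{v, u, u'}. c v j) + (\<Sum>j\<in>J - {v, u, u'}. c v j)"
      using u v fin by (subst sum.subset_diff[of "{v, u, u'}"]) (auto simp: add.commute)
    moreover have "(\<Sum>j\<in>{v, u, u'}. c v j) \<le> 0"
      using u v neg[of u] neg[of u'] c_diag[of v] assms by (auto simp: adjacent_def)
    moreover have "(\<Sum>j\<in>J - {v, u, u'}. c v j) \<le> 0"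
      using v assms by (intro sum_nonpos c_nonpos) auto
    ultimately show "(\<Sum>j\<in>J. c v j) \<le> 0" by linarith
  qed
  finally have "(\<Sum>i\<in>I. \<Sum>j\<in>I. d i * c i j * x i * x j) \<le> 0" .
  moreover have "\<exists>i\<in>I. x i \<noteq> 0" using assms by (auto simp: x_def)
  ultimately show False using form_pos[of x] by simp
qed

text \<open>Rotation of \<open>a\<close> is the only real case. If \<open>v\<close> and
  \<open>a\<close> are not adjacent, swap them and rotate \<open>a\<close> away. Otherwise
  \<open>a\<close> is the only neighbour of \<open>v\<close>: rotate first \<open>v\<close> and then
  \<open>a\<close> to the end, and move \<open>v\<close> back to the front through
  \<open>xs\<close>, with which it commutes.\<close>

lemma cox_equiv_Cons_leaf:
  assumes "cox_equiv c r r'" "distinct r" "insert v (set r) \<subseteq> I"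
    and "\<forall>u\<in>set r. \<forall>u'\<in>set r. adjacent c v u \<longrightarrow> adjacent c v u' \<longrightarrow> u = u'"
  shows "cox_equiv c (v # r) (v # r')"
  using assms
proof (induction rule: cox_equiv.induct)
  case (cox_swap a b xs ys)
  show ?case using cox_equiv.cox_swap[OF cox_swap.hyps, of "v # xs" ys] by simp
next
  case (cox_rotate a xs)
  show ?case
  proof (cases "adjacent c v a")
    case False
    then have "cox_equiv c (v # a # xs) (a # v # xs)"
      using cox_equiv.cox_swap[of c v a "[]" xs] by simp
    moreover have "cox_equiv c (a # v # xs) (v # xs @ [a])"
      using cox_equiv.cox_rotate[of c a "v # xs"] by simp
    ultimately show ?thesis by (rule cox_equiv.cox_trans)
  next
    case True
    then have "\<forall>b\<in>set xs. \<not> adjacent c b v"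
      using cox_rotate.prems adjacent_sym[of _ v] by (metis distinct.simps(2) insert_subset list.set_intros subset_code(1))
    then have "cox_equiv c (xs @ v # [a]) (v # xs @ [a])"
      using cox_equiv_move[of xs c v "[]" "[a]"] by simp
    moreover have "cox_equiv c (v # a # xs) (a # xs @ [v])"
      using cox_equiv.cox_rotate[of c v "a # xs"] by simp
    moreover have "cox_equiv c (a # xs @ [v]) (xs @ v # [a])"
      using cox_equiv.cox_rotate[of c a "xs @ [v]"] by simp
    ultimately show ?thesis by (blast intro: cox_equiv.cox_trans)
  qed
next
  case (cox_sym xs ys)
  have "set xs = set ys" "distinct xs"
    using cox_equiv_set[OF cox_sym.hyps] cox_equiv_distinct[OF cox_sym.hyps] cox_sym.prems(1) by simp_all
  then show ?case
    using cox_sym.prems by (intro cox_equiv.cox_sym[OF cox_sym.IH]) (simp_all only:)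
next
  case (cox_trans xs ys zs)
  have "set xs = set ys" "distinct ys"
    using cox_equiv_set[OF cox_trans.hyps(1)] cox_equiv_distinct[OF cox_trans.hyps(1)] cox_trans.prems(1)
    by simp_all
  then show ?case
    using cox_trans.prems by (intro cox_equiv.cox_trans[OF cox_trans.IH]) (simp_all only:)
qed (rule cox_equiv.cox_refl)

text \<open>The single possible neighbour of \<open>v\<close> lies on one side at most. So
  \<open>v\<close> moves freely either left to the front, or right to the end and from there to the
  front by a rotation.\<close>

lemma cox_equiv_leaf_front:
  assumes "distinct (p @ v # q)" "set (p @ v # q) \<subseteq> I"
    and leaf: "\<forall>u\<in>set (p @ v # q). \<forall>u'\<in>set (p @ v # q). adjacent c v u \<longrightarrow> adjacent c v u' \<longrightarrow> u = u'"
  shows "cox_equiv c (p @ v # q) (v # p @ q)"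
proof (cases "\<exists>u\<in>set p. adjacent c v u")
  case False
  have "\<forall>b\<in>set p. \<not> adjacent c b v"
  proof
    fix b assume "b \<in> set p"
    then show "\<not> adjacent c b v" using False adjacent_sym[of b v] assms(2) by auto
  qed
  then show ?thesis using cox_equiv_move[of p c v "[]" q] by simp
next
  case True
  then obtain u where u: "u \<in> set p" "adjacent c v u" by blast
  have "\<not> adjacent c b v" if b: "b \<in> set q" for b
  proof
    assume "adjacent c b v"
    then have "adjacent c v b" using adjacent_sym[of b v] assms(2) b by auto
    moreover have "b \<in> set (p @ v # q)" "u \<in> set (p @ v # q)" using b u by simp_all
    ultimately have "u = b" using leaf u(2) by blast
    then show False using assms(1) u(1) b by auto
  qed
  then have "cox_equiv c (p @ q @ [v]) (p @ v # q)"
    using cox_equiv_move[of q c v p "[]"] by simp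
  moreover have "cox_equiv c (v # p @ q) (p @ q @ [v])"
    using cox_equiv.cox_rotate[of c v "p @ q"] by simp
  ultimately show ?thesis by (blast intro: cox_equiv.cox_sym cox_equiv.cox_trans)
qed

text \<open>Induction on the number of letters: \<open>exists_leaf\<close> supplies a leaf of the
  letters present, both words are brought to start with it, and the remaining words are equivalent
  by induction.\<close>

lemma cox_equiv_all:
  assumes "distinct xs" "distinct ys" "set xs = set ys" "set xs \<subseteq> I"
  shows "cox_equiv c xs ys"
  using assms
proof (induction "length xs" arbitrary: xs ys)
  case 0
  then show ?case by (simp add: cox_equiv.cox_refl)
next
  case (Suc n)
  then have "set xs \<noteq> {}" by auto
  then obtain v where v: "v \<in> set xs"
    and leaf: "\<forall>u\<in>set xs. \<forall>u'\<in>set xs. adjacent c v u \<longrightarrow> adjacent c v u' \<longrightarrow> u = u'"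
    using exists_leaf[of "set xs"] Suc.prems by blast
  obtain p q where xs: "xs = p @ v # q" using v by (auto dest: split_list)
  obtain p' q' where ys: "ys = p' @ v # q'" using v Suc.prems by (auto dest: split_list)
  have "set (p @ q) = set xs - {v}" using xs Suc.prems by auto
  also have "\<dots> = set (p' @ q')" using ys Suc.prems(2,3) by auto
  finally have sets: "set (p @ q) = set (p' @ q')" .
  have "n = length (p @ q)" "distinct (p @ q)" "distinct (p' @ q')" "set (p @ q) \<subseteq> I"
    "insert v (set (p @ q)) \<subseteq> I" and sub: "set (p @ q) \<subseteq> set xs"
    using Suc.hyps(2) Suc.prems(1,2,4) xs ys by auto
  then have "cox_equiv c (p @ q) (p' @ q')"
    using sets by (intro Suc.hyps(1))
  then have "cox_equiv c (v # p @ q) (v # p' @ q')"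
    by (rule cox_equiv_Cons_leaf) (fact | use leaf sub in blast)+
  moreover have "cox_equiv c xs (v # p @ q)"
    unfolding xs by (rule cox_equiv_leaf_front) (use Suc.prems leaf in \<open>simp_all only: xs\<close>)
  moreover have "cox_equiv c ys (v # p' @ q')"
    unfolding ys by (rule cox_equiv_leaf_front) (use Suc.prems leaf in \<open>simp_all only: ys\<close>)
  ultimately show ?case by (blast intro: cox_equiv.cox_sym cox_equiv.cox_trans)
qed

lemma reflection_commute:
  assumes "a \<in> I" "b \<in> I" "\<not> adjacent c a b"
  shows "reflection I c a \<circ> reflection I c b = reflection I c b \<circ> reflection I c a"
proof (cases "a = b")
  case False
  then have "c a b = 0" "c b a = 0" using assms c_eq_0_sym by (auto simp: adjacent_def)
  have pair: "pairing I c i (\<lambda>k. \<beta> k - m * simple_root j k) = pairing I c i \<beta> - m * c i j"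
    if "j \<in> I" for i j \<beta> m
    using pairing_simple_root[OF finite_I that, of c i]
    by (simp add: pairing_def left_diff_distrib sum_subtractf mult.assoc sum_distrib_left[symmetric])
  show ?thesis
    using \<open>c a b = 0\<close> \<open>c b a = 0\<close> assms by (simp add: fun_eq_iff reflection_eq pair)
qed simp

lemma cox_equiv_funpow_id:
  assumes "cox_equiv c xs ys" "set xs \<subseteq> I"
  shows "(word_action I c xs ^^ n) = id \<longleftrightarrow> (word_action I c ys ^^ n) = id"
  using assms
proof (induction rule: cox_equiv.induct)
  case (cox_swap a b xs ys)
  then have "word_action I c (xs @ a # b # ys) = word_action I c (xs @ b # a # ys)"
    using reflection_commute[of a b] by (simp add: word_action_append o_assoc)
  then show ?case by simp
next
  case (cox_rotate a xs)
  have "reflection I c a \<circ> reflection I c a = id"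
    using cox_rotate by (auto simp: reflection_involution)
  from funpow_comp_involution[OF this, of n "word_action I c xs"]
  show ?case by (simp only: word_action_snoc word_action_Cons)
next
  case (cox_sym xs ys)
  then show ?case using cox_equiv_set by blast
next
  case (cox_trans xs ys zs)
  then show ?case using cox_equiv_set by blast
qed simp

text \<open>Lets the enumeration be chosen at will; for \<triangle> it will be the lift of an
  enumeration of the orbits.\<close>

lemma coxeter_number_eq:
  assumes "distinct xs" "set xs = I"
  shows "coxeter_number I c = (LEAST n. n > 0 \<and> (word_action I c xs ^^ n) = id)"
  unfolding coxeter_number_def
proof (rule the_equality)
  show "\<forall>ys. distinct ys \<and> set ys = I \<longrightarrow> (LEAST n. n > 0 \<and> (word_action I c xs ^^ n) = id)
      = (LEAST n. n > 0 \<and> (word_action I c ys ^^ n) = id)"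
  proof (intro allI impI)
    fix ys assume "distinct ys \<and> set ys = I"
    then have "cox_equiv c xs ys" using assms by (intro cox_equiv_all) auto
    then show "(LEAST n. n > 0 \<and> (word_action I c xs ^^ n) = id)
      = (LEAST n. n > 0 \<and> (word_action I c ys ^^ n) = id)"
      using cox_equiv_funpow_id assms by simp
  qed
qed (use assms in blast)

end

subsection \<open>The normalized invariant form\<close>

lemma bilinear_form_simple_root:
  assumes "finite I" "i \<in> I" "j \<in> I"
  shows "bilinear_form I G (simple_root i) (simple_root j) = G i j"
proof -
  have "bilinear_form I G (simple_root i) (simple_root j)
    = (\<Sum>k\<in>I. if k = i then (\<Sum>l\<in>I. if l = j then G i j else 0) else 0)"
    unfolding bilinear_form_def by (intro sum.cong refl) (auto simp: simple_root_def intro!: sum.cong)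
  then show ?thesis using assms by simp
qed

lemma bilinear_form_uminus_left:
  "bilinear_form I G (\<lambda>k. - \<beta> k) \<gamma> = - bilinear_form I G \<beta> \<gamma>"
  by (simp add: bilinear_form_def sum_negf)

lemma bilinear_form_diff_scale_right:
  "bilinear_form I G \<beta> (\<lambda>k. \<gamma> k - m * \<gamma>' k)
     = bilinear_form I G \<beta> \<gamma> - of_int m * bilinear_form I G \<beta> \<gamma>'"
  by (simp add: bilinear_form_def algebra_simps sum_subtractf sum_distrib_left)

context cartan_form
begin

text \<open>Invariance under s_i, evaluated on the pair \<alpha>_i, \<alpha>_j.\<close>

lemma invariant_form_entry:
  assumes G: "normalized_invariant_form I c G" and ij: "i \<in> I" "j \<in> I"
  shows "2 * G i j = of_int (c i j) * G i i"
proof -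
  have "word_action I c [i] \<in> weyl_group I c" using ij by (intro weyl_groupI) auto
  then have "bilinear_form I G (reflection I c i (simple_root i)) (reflection I c i (simple_root j))
    = bilinear_form I G (simple_root i) (simple_root j)"
    using G by (auto simp: normalized_invariant_form_def)
  moreover have "reflection I c i (simple_root i) = (\<lambda>k. - simple_root i k)"
    "reflection I c i (simple_root j) = (\<lambda>k. simple_root j k - c i j * simple_root i k)"
    using ij finite_I by (auto simp: reflection_simple_root) (simp add: reflection_eq)
  ultimately show ?thesis
    using ij finite_I
    by (simp add: bilinear_form_uminus_left bilinear_form_diff_scale_right bilinear_form_simple_root)
qed

text \<open>Along an edge, the symmetry of \<open>G\<close> and the symmetriser \<open>d\<close> fix
  the ratio of the two diagonal entries; connectedness propagates it.\<close>

lemma invariant_form_diag_ratio: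
  assumes G: "normalized_invariant_form I c G" and conn: "connected_diagram I c"
    and ij: "i \<in> I" "j \<in> I"
  shows "G i i * of_int (d j) = G j j * of_int (d i)"
proof -
  have edge: "G k k * of_int (d l) = G l l * of_int (d k)"
    if kl: "k \<in> I" "l \<in> I" "adjacent c k l" for k l
  proof -
    have "G k l = G l k" using G kl by (simp add: normalized_invariant_form_def)
    then have "of_int (c k l) * G k k = of_int (c l k) * G l l"
      using invariant_form_entry[OF G kl(1,2)] invariant_form_entry[OF G kl(2,1)] by simp
    moreover have "(of_int (d k * c k l) :: rat) = of_int (d l * c l k)"
      using d_sym kl by simp
    ultimately have "of_int (c k l) * (G k k * of_int (d l)) = of_int (c k l) * (G l l * of_int (d k) :: rat)"
      by (simp add: mult_ac)
    then show ?thesis using kl by (simp add: adjacent_def)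
  qed
  have "(i, j) \<in> {(k, l). k \<in> I \<and> l \<in> I \<and> adjacent c k l}\<^sup>*"
    using conn ij by (auto simp: connected_diagram_def)
  then show ?thesis
  proof (induction rule: rtrancl_induct)
    case (step k l)
    then have kl: "k \<in> I" "l \<in> I" "adjacent c k l" by auto
    have "of_int (d k) * (G i i * of_int (d l)) = of_int (d k) * (G l l * of_int (d i))"
      using step.IH edge[OF kl] by algebra
    then show ?case using d_pos[OF kl(1)] by simp
  qed simp
qed

lemma invariant_form_roots:
  assumes G: "normalized_invariant_form I c G"
  shows "(\<lambda>\<alpha>. bilinear_form I G \<alpha> \<alpha>) ` roots I c = (\<lambda>i. G i i) ` I"
proof (intro equalityI subsetI)
  fix r assume "r \<in> (\<lambda>\<alpha>. bilinear_form I G \<alpha> \<alpha>) ` roots I c"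
  then obtain w i where w: "w \<in> weyl_group I c" "i \<in> I"
    "r = bilinear_form I G (w (simple_root i)) (w (simple_root i))"
    by (auto simp: roots_def)
  then have "r = bilinear_form I G (simple_root i) (simple_root i)"
    using G by (auto simp: normalized_invariant_form_def)
  then have "r = G i i" using bilinear_form_simple_root[OF finite_I w(2) w(2)] by simp
  with w(2) show "r \<in> (\<lambda>i. G i i) ` I" by blast
next
  fix r assume "r \<in> (\<lambda>i. G i i) ` I"
  then obtain i where i: "i \<in> I" "r = G i i" by blast
  then have "r = bilinear_form I G (simple_root i) (simple_root i)"
    using finite_I by (simp add: bilinear_form_simple_root)
  then show "r \<in> (\<lambda>\<alpha>. bilinear_form I G \<alpha> \<alpha>) ` roots I c"
    using i(1) simple_root_in_roots[of i I c] by blast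
qed

text \<open>Existence is witnessed by the Gram matrix \<open>d i * c i j\<close>. For uniqueness,
  every normalised form has diagonal proportional to \<open>d\<close>, and a vertex with
  \<open>d = 1\<close> pins the factor.\<close>

lemma half_norm_eq:
  assumes conn: "connected_diagram I c" and one: "\<exists>i\<in>I. d i = 1" and i: "i \<in> I"
  shows "half_norm I c i = of_int (d i)"
  unfolding half_norm_def
proof (rule the_equality)
  obtain i\<^sub>1 where i1: "i\<^sub>1 \<in> I" "d i\<^sub>1 = 1" using one by blast
  define G where "G i j = (of_int (d i * c i j) :: rat)" for i j
  have bil: "bilinear_form I G \<beta> \<gamma> = of_int (form \<beta> \<gamma>)" for \<beta> \<gamma>
    by (simp add: bilinear_form_def form_def G_def mult_ac)
  have inv: "bilinear_form I G (w \<beta>) (w \<gamma>) = bilinear_form I G \<beta> \<gamma>"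
    if "w \<in> weyl_group I c" for w \<beta> \<gamma>
    using that by (elim weyl_groupE) (simp add: bil form_word_action)
  have "(\<lambda>\<alpha>. bilinear_form I G \<alpha> \<alpha>) ` roots I c = (\<lambda>i. of_int (2 * d i)) ` I"
  proof (intro equalityI subsetI)
    fix r assume "r \<in> (\<lambda>\<alpha>. bilinear_form I G \<alpha> \<alpha>) ` roots I c"
    then show "r \<in> (\<lambda>i. of_int (2 * d i)) ` I"
      by (auto simp: bil form_word_action form_simple_root_self elim!: rootsE)
  next
    fix r :: rat assume "r \<in> (\<lambda>i. of_int (2 * d i)) ` I"
    then obtain i where "i \<in> I" "r = bilinear_form I G (simple_root i) (simple_root i)"
      by (auto simp: bil form_simple_root_self)
    then show "r \<in> (\<lambda>\<alpha>. bilinear_form I G \<alpha> \<alpha>) ` roots I c"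
      using simple_root_in_roots[of _ I c] by blast
  qed
  moreover have "Min ((\<lambda>i. of_int (2 * d i) :: rat) ` I) = 2"
  proof (rule Min_eqI)
    fix y :: rat assume "y \<in> (\<lambda>i. of_int (2 * d i)) ` I"
    then obtain i where "i \<in> I" "y = of_int (2 * d i)" by blast
    moreover have "2 \<le> 2 * d i" using d_pos[OF \<open>i \<in> I\<close>] by simp
    ultimately show "2 \<le> y" by (metis of_int_le_iff of_int_numeral)
  next
    have "(2 :: rat) = of_int (2 * d i\<^sub>1)" using i1 by simp
    then show "(2 :: rat) \<in> (\<lambda>i. of_int (2 * d i)) ` I" using i1 by blast
  qed (use finite_I in simp)
  ultimately have "normalized_invariant_form I c G"
    unfolding normalized_invariant_form_def using d_sym inv by (simp add: G_def)
  moreover have "of_int (d i) = bilinear_form I G (simple_root i) (simple_root i) / 2"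
    using i by (simp add: bil form_simple_root_self)
  ultimately show "\<exists>G. normalized_invariant_form I c G
      \<and> of_int (d i) = bilinear_form I G (simple_root i) (simple_root i) / 2" by blast
  fix r assume "\<exists>G. normalized_invariant_form I c G
    \<and> r = bilinear_form I G (simple_root i) (simple_root i) / 2"
  then obtain G where G: "normalized_invariant_form I c G"
    and r: "r = bilinear_form I G (simple_root i) (simple_root i) / 2" by blast
  define \<kappa> where "\<kappa> = G i\<^sub>1 i\<^sub>1"
  have g: "G j j = \<kappa> * of_int (d j)" if "j \<in> I" for j
    using invariant_form_diag_ratio[OF G conn that i1(1)] i1 by (simp add: \<kappa>_def)
  have Min2: "Min ((\<lambda>i. G i i) ` I) = 2"
    using G invariant_form_roots[OF G] by (simp add: normalized_invariant_form_def)
  have "2 \<in> (\<lambda>i. G i i) ` I"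
    using Min_in[of "(\<lambda>i. G i i) ` I"] finite_I i1 Min2 by auto
  \<comment> \<open>The minimum 2 is attained at this \<open>j\<close>. Since \<kappa> is itself a
    diagonal entry, 2 \<le> \<kappa>; together with \<kappa> \<le> \<kappa> * d j = 2 this forces
    \<kappa> = 2.\<close>
  then obtain j where j: "j \<in> I" "\<kappa> * of_int (d j) = 2" using g by force
  have "2 \<le> \<kappa>"
    using Min_le[of "(\<lambda>i. G i i) ` I" \<kappa>] finite_I i1 Min2 by (auto simp: \<kappa>_def)
  moreover have "\<kappa> * 1 \<le> \<kappa> * of_int (d j)"
    using d_pos[OF j(1)] \<open>2 \<le> \<kappa>\<close> by (intro mult_left_mono) auto
  ultimately have "\<kappa> = 2" using j by simp
  then show "r = of_int (d i)"
    using r i finite_I g by (simp add: bilinear_form_simple_root)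
qed

end

subsection \<open>Automorphisms of forests\<close>

lemma relpow_sym: "sym R \<Longrightarrow> (a, b) \<in> R ^^ n \<Longrightarrow> (b, a) \<in> R ^^ n"
proof (induction n arbitrary: b)
  case (Suc n)
  then obtain y where "(a, y) \<in> R ^^ n" "(y, b) \<in> R" by auto
  then have "(b, y) \<in> R" "(y, a) \<in> R ^^ n" using Suc by (auto dest: symD)
  then show ?case by (rule relpow_Suc_I2)
qed simp

lemma relpow_subpath:
  assumes "\<forall>i<k. (p i, p (Suc i)) \<in> R" "a \<le> b" "b \<le> k"
  shows "(p a, p b) \<in> R ^^ (b - a)"
  unfolding relpow_fun_conv using assms by (intro exI[of _ "\<lambda>i. p (a + i)"]) auto

text \<open>Walks of length \<open>n\<close> are then the pairs in
  \<open>edges I c ^^ n\<close>.\<close>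

definition edges :: "'a set \<Rightarrow> ('a \<Rightarrow> 'a \<Rightarrow> int) \<Rightarrow> ('a \<times> 'a) set" where
  "edges I c = {(k, l). k \<in> I \<and> l \<in> I \<and> adjacent c k l}"

context cartan_form
begin

lemma sym_edges: "sym (edges I c)"
  using adjacent_sym by (auto simp: edges_def intro!: symI)

context
  fixes \<tau> :: "'a \<Rightarrow> 'a"
  assumes perm: "\<tau> permutes I" and aut: "\<And>i j. i \<in> I \<Longrightarrow> j \<in> I \<Longrightarrow> c (\<tau> i) (\<tau> j) = c i j"
begin

lemma edges_aut: "(a, b) \<in> edges I c \<Longrightarrow> (\<tau> a, \<tau> b) \<in> edges I c"
  using permutes_in_image[OF perm] permutes_inj[OF perm] aut
  by (auto simp: edges_def adjacent_def inj_eq)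

lemma edges_aut_funpow: "(a, b) \<in> edges I c \<Longrightarrow> ((\<tau> ^^ m) a, (\<tau> ^^ m) b) \<in> edges I c"
  by (induction m) (auto intro: edges_aut)

lemma walk_aut_funpow:
  "(a, b) \<in> edges I c ^^ n \<Longrightarrow> ((\<tau> ^^ m) a, (\<tau> ^^ m) b) \<in> edges I c ^^ n"
  by (induction n arbitrary: b) (auto intro: edges_aut_funpow)

text \<open>Translating a walk from \<open>x\<close> to \<open>\<tau> x\<close> of length at least two by the powers of \<open>\<tau>\<close> yields a
  closed walk. The diagram contains no cycles, hence this closed walk backtracks somewhere, and
  cutting off the backtrack shortens the original walk by two.\<close>

lemma walk_shorten:
  assumes walk: "(x, \<tau> x) \<in> edges I c ^^ Suc (Suc k)"
  shows "\<exists>y\<in>I. (y, \<tau> y) \<in> edges I c ^^ k"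
proof (rule ccontr)
  assume no: "\<not> ?thesis"
  define K where "K = Suc (Suc k)"
  obtain p where p: "p 0 = x" "p K = \<tau> x" and step: "\<forall>i<K. (p i, p (Suc i)) \<in> edges I c"
    using walk unfolding relpow_fun_conv K_def by blast
  have pI: "p i \<in> I" if "i \<le> K" for i
    using step that by (cases "i = K") (auto simp: edges_def K_def less_le)
  have inner: "p j \<noteq> p (Suc (Suc j))" if "Suc (Suc j) \<le> K" for j
  proof
    assume "p j = p (Suc (Suc j))"
    then have "(p 0, p j) \<in> edges I c ^^ j" "(p j, p K) \<in> edges I c ^^ (K - Suc (Suc j))"
      using relpow_subpath[OF step, of 0 j] relpow_subpath[OF step, of "Suc (Suc j)" K] that
      by simp_all
    then have "(p 0, p K) \<in> edges I c ^^ (j + (K - Suc (Suc j)))"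
      unfolding relpow_add by blast
    moreover have "j + (K - Suc (Suc j)) = k" using that by (simp add: K_def)
    ultimately show False using no p pI[of 0] by auto
  qed
  \<comment> \<open>This concerns the junction of the walk with its translate. A backtrack there
    would leave a walk from \<open>p 1\<close> to \<open>\<tau> (p 1)\<close> that is two steps
    shorter.\<close>
  have outer: "p (Suc k) \<noteq> \<tau> (p 1)"
  proof
    assume "p (Suc k) = \<tau> (p 1)"
    then have "(p 1, \<tau> (p 1)) \<in> edges I c ^^ k"
      using relpow_subpath[OF step, of 1 "Suc k"] by (simp add: K_def)
    then show False using no pI[of 1] by (auto simp: K_def)
  qed
  have "permutation \<tau>" using perm finite_I permutation_permutes by blast
  then have "x \<in> orbit \<tau> x" by (rule permutation_self_in_orbit)
  then obtain n where "0 < n" "x = (\<tau> ^^ n) x" by (auto simp: orbit_altdef)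
  then have n: "p 0 = (\<tau> ^^ (n - 1)) (p K)"
    using p by (cases n) (simp_all add: funpow_swap1)
  \<comment> \<open>The vertex set of the closed walk. Index 0 may be left out because
    \<open>p 0\<close> is a translate of \<open>p K\<close>.\<close>
  define J where "J = {(\<tau> ^^ m) (p j) | m j. 1 \<le> j \<and> j \<le> K}"
  have powI: "(\<tau> ^^ m) i \<in> I" if "i \<in> I" for m i
    using that by (induction m) (auto simp: permutes_in_image[OF perm])
  have JI: "J \<subseteq> I" using pI powI by (auto simp: J_def)
  have Jin: "(\<tau> ^^ m) (p j) \<in> J" if "1 \<le> j" "j \<le> K" for m j
    using that by (auto simp: J_def)
  have ne: "J \<noteq> {}" using Jin[of 1 0] by (auto simp: K_def)
  have inj: "(\<tau> ^^ m) a = (\<tau> ^^ m) b \<longleftrightarrow> a = b" for m a b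
    using permutes_inj[OF perm] by (simp add: inj_fn inj_eq)
  have "\<exists>u\<in>J. \<exists>u'\<in>J. adjacent c v u \<and> adjacent c v u' \<and> u \<noteq> u'" if vJ: "v \<in> J" for v
  proof -
    obtain m j where v: "v = (\<tau> ^^ m) (p j)" "1 \<le> j" "j \<le> K"
      using vJ unfolding J_def by blast
    then obtain j' where j': "j = Suc j'" by (cases j) auto
    define u where "u = p j'"
    define u' where "u' = (if j = K then \<tau> (p 1) else p (Suc j))"
    have "(u, p j) \<in> edges I c" using step v j' by (simp add: u_def)
    moreover have "(p j, u') \<in> edges I c"
      using step v p edges_aut[of x "p 1"] by (auto simp: u'_def K_def)
    moreover have "u \<noteq> u'"
      using inner[of j'] outer j' v by (auto simp: u_def u'_def K_def)
    moreover have "(\<tau> ^^ m) u \<in> J"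
    proof (cases j')
      case 0
      then have "(\<tau> ^^ m) u = (\<tau> ^^ (m + (n - 1))) (p K)" by (simp add: u_def n funpow_add)
      then show ?thesis using Jin[of K] by (simp add: K_def)
    qed (use v j' Jin[of j'] in \<open>simp add: u_def\<close>)
    moreover have "(\<tau> ^^ m) u' \<in> J"
    proof (cases "j = K")
      case True
      then have "(\<tau> ^^ m) u' = (\<tau> ^^ Suc m) (p 1)" by (simp add: u'_def funpow_swap1)
      then show ?thesis using Jin[of 1 "Suc m"] by (simp add: K_def)
    qed (use v Jin[of "Suc j"] in \<open>simp add: u'_def\<close>)
    moreover have "((\<tau> ^^ m) (p j), (\<tau> ^^ m) u) \<in> edges I c"
      using \<open>(u, p j) \<in> edges I c\<close> sym_edges by (intro edges_aut_funpow) (rule symD)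
    moreover have "((\<tau> ^^ m) (p j), (\<tau> ^^ m) u') \<in> edges I c"
      using \<open>(p j, u') \<in> edges I c\<close> by (rule edges_aut_funpow)
    ultimately show ?thesis
      unfolding v(1)
      by (intro bexI[of _ "(\<tau> ^^ m) u"] bexI[of _ "(\<tau> ^^ m) u'"]) (simp_all add: inj edges_def)
  qed
  then show False using exists_leaf[OF JI ne] by blast
qed

text \<open>Repeated shortening by two stops at length 0, a fixed vertex, or at length 1, a vertex
  adjacent to its image.\<close>

lemma walk_parity:
  assumes "x \<in> I" "(x, \<tau> x) \<in> edges I c ^^ k"
  shows "\<exists>y\<in>I. (y, \<tau> y) \<in> edges I c ^^ (k mod 2)"
  using assms
proof (induction k arbitrary: x rule: less_induct)
  case (less k)
  show ?case
  proof (cases "k < 2")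
    case False
    then obtain k' where k: "k = Suc (Suc k')" by (metis add_2_eq_Suc le_Suc_ex linorder_not_less)
    then obtain y where "y \<in> I" "(y, \<tau> y) \<in> edges I c ^^ k'"
      using walk_shorten less.prems by blast
    then have "\<exists>y\<in>I. (y, \<tau> y) \<in> edges I c ^^ (k' mod 2)" using less.IH[of k'] k by simp
    then show ?thesis by (simp add: k)
  qed (use less.prems in auto)
qed

end

text \<open>Bipartiteness as the case \<tau> = id of the parity argument: an odd closed walk would
  shrink to a loop.\<close>

lemma even_closed_walk:
  assumes "x \<in> I" "(x, x) \<in> edges I c ^^ k"
  shows "even k"
proof (rule ccontr)
  assume "odd k"
  then have "\<exists>y\<in>I. (y, y) \<in> edges I c ^^ 1"
    using walk_parity[of id x k] assms permutes_id by (simp add: odd_iff_mod_2_eq_one)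
  then show False by (auto simp: edges_def adjacent_def)
qed

text \<open>Connectedness gives a walk from some \<open>x\<close> to \<open>\<sigma> x\<close>.
  Shrinking it ends in a fixed vertex, as the other outcome is excluded by
  \<open>nonadj\<close>.\<close>

lemma automorphism_fixes_vertex:
  assumes perm: "\<sigma> permutes I" and aut: "\<And>i j. i \<in> I \<Longrightarrow> j \<in> I \<Longrightarrow> c (\<sigma> i) (\<sigma> j) = c i j"
    and conn: "connected_diagram I c" and nonadj: "\<And>i. i \<in> I \<Longrightarrow> \<not> adjacent c i (\<sigma> i)"
  shows "\<exists>i\<in>I. \<sigma> i = i"
proof -
  obtain x where x: "x \<in> I" using conn by (auto simp: connected_diagram_def)
  then have "(x, \<sigma> x) \<in> (edges I c)\<^sup>*"
    using conn permutes_in_image[OF perm] by (auto simp: connected_diagram_def edges_def)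
  then obtain k where "(x, \<sigma> x) \<in> edges I c ^^ k" by (metis rtrancl_imp_relpow)
  then obtain y where y: "y \<in> I" "(y, \<sigma> y) \<in> edges I c ^^ (k mod 2)"
    using walk_parity[OF perm aut x] by blast
  show ?thesis
  proof (cases "even k")
    case True
    then have "\<sigma> y = y" using y(2) by (simp add: even_iff_mod_2_eq_zero)
    then show ?thesis using y(1) by blast
  next
    case False
    then have "adjacent c y (\<sigma> y)" using y(2) by (auto simp: odd_iff_mod_2_eq_one edges_def)
    then show ?thesis using nonadj y(1) by blast
  qed
qed

text \<open>A power of \<sigma> maps a walk from the fixed vertex to \<open>i\<close> onto one of
  the same length \<open>n\<close> to \<open>j\<close>. An edge between \<open>i\<close> and
  \<open>j\<close> would close a walk of odd length 2n + 1.\<close>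

lemma orbit_not_adjacent:
  assumes perm: "\<sigma> permutes I" and aut: "\<And>i j. i \<in> I \<Longrightarrow> j \<in> I \<Longrightarrow> c (\<sigma> i) (\<sigma> j) = c i j"
    and conn: "connected_diagram I c" and fixp: "f \<in> I" "\<sigma> f = f"
    and i: "i \<in> I" and j: "j \<in> orbit \<sigma> i"
  shows "\<not> adjacent c i j"
proof
  assume adj: "adjacent c i j"
  obtain m where m: "j = (\<sigma> ^^ m) i" using j by (auto simp: orbit_altdef)
  have "j \<in> I" unfolding m using i by (induction m) (auto simp: permutes_in_image[OF perm])
  have fm: "(\<sigma> ^^ m) f = f" using fixp(2) by (induction m) auto
  have "(f, i) \<in> (edges I c)\<^sup>*" using conn fixp i by (auto simp: connected_diagram_def edges_def)
  then obtain n where n: "(f, i) \<in> edges I c ^^ n" by (metis rtrancl_imp_relpow)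
  have "(f, j) \<in> edges I c ^^ n" using walk_aut_funpow[OF perm aut n, of m] fm m by simp
  then have "(j, f) \<in> edges I c ^^ n" by (rule relpow_sym[OF sym_edges])
  moreover have "(i, j) \<in> edges I c" using adj i \<open>j \<in> I\<close> by (simp add: edges_def)
  ultimately have "(f, f) \<in> edges I c ^^ (Suc n + n)"
    using n unfolding relpow_add relpow.simps by blast
  then show False using even_closed_walk fixp(1) by fastforce
qed

end

subsection \<open>Simply-laced diagrams\<close>

text \<open>Off-diagonal terms occur in equal pairs and diagonal terms are even.\<close>

lemma even_form:
  fixes c :: "'a \<Rightarrow> 'a \<Rightarrow> int" and x :: "'a \<Rightarrow> int"
  assumes "finite A" "\<And>i. i \<in> A \<Longrightarrow> even (c i i)" "\<And>i j. i \<in> A \<Longrightarrow> j \<in> A \<Longrightarrow> c i j = c j i"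
  shows "even (\<Sum>i\<in>A. \<Sum>j\<in>A. c i j * x i * x j)"
  using assms
proof (induction A rule: finite_induct)
  case (insert a A)
  have "(\<Sum>i\<in>insert a A. \<Sum>j\<in>insert a A. c i j * x i * x j)
    = c a a * x a * x a + (\<Sum>j\<in>A. c a j * x a * x j) + (\<Sum>i\<in>A. c i a * x i * x a)
      + (\<Sum>i\<in>A. \<Sum>j\<in>A. c i j * x i * x j)"
    using insert.hyps by (simp add: sum.distrib)
  moreover have "(\<Sum>i\<in>A. c i a * x i * x a) = (\<Sum>j\<in>A. c a j * x a * x j)"
    using insert.prems(2) by (intro sum.cong) auto
  moreover have "even (\<Sum>i\<in>A. \<Sum>j\<in>A. c i j * x i * x j)"
    using insert.prems by (intro insert.IH) auto
  ultimately show ?case using insert.prems(1) by simp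
qed simp

text \<open>A root \<open>\<beta>\<close> of a simply-laced diagram has norm \<open>2\<close>. Its positive and negative part \<open>P\<close> and
  \<open>N\<close> have disjoint supports, hence \<open>(P, N) \<le> 0\<close> and \<open>2 \<ge> (P, P) + (N, N)\<close>; since the form is even
  and positive definite, one of \<open>P\<close> and \<open>N\<close> vanishes.\<close>

lemma (in cartan_form) roots_coherent:
  assumes d: "d = (\<lambda>_. 1)" and \<beta>: "\<beta> \<in> roots I c"
  shows "nonneg \<beta> \<or> nonneg (\<lambda>k. - \<beta> k)"
proof -
  define P where "P k = max (\<beta> k) 0" for k
  define N where "N k = max (- \<beta> k) 0" for k
  have \<beta>_eq: "\<beta> = (\<lambda>k. P k - 1 * N k)" by (auto simp: P_def N_def fun_eq_iff)
  obtain xs i where "set xs \<subseteq> I" "i \<in> I" "\<beta> = word_action I c xs (simple_root i)"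
    using \<beta> by (rule rootsE)
  then have "form \<beta> \<beta> = 2"
    using form_word_action form_simple_root_self[of i] d by simp
  moreover have "form \<beta> \<beta> = form P P - 2 * form P N + form N N"
    unfolding \<beta>_eq form_diff_scale_left form_diff_scale_right using form_commute[of N P] by simp
  moreover have "form P N \<le> 0"
    unfolding form_def
  proof (intro sum_nonpos)
    fix i j assume ij: "i \<in> I" "j \<in> I"
    show "d i * c i j * P i * N j \<le> 0"
    proof (cases "i = j")
      case True
      then show ?thesis by (simp add: P_def N_def max_def)
    next
      case False
      then have "c i j * (P i * N j) \<le> 0"
        using c_nonpos[OF ij] by (intro mult_nonpos_nonneg) (auto simp: P_def N_def)
      then show ?thesis by (simp add: d mult.assoc)
    qed
  qed
  ultimately have le: "form P P + form N N \<le> 2" by linarith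
  have sym: "c i j = c j i" if "i \<in> I" "j \<in> I" for i j
    using d_sym[OF that] by (simp add: d)
  have two: "2 \<le> form x x" if "\<exists>i\<in>I. x i \<noteq> 0" for x
  proof -
    have "0 < form x x" unfolding form_def using that by (rule form_pos)
    moreover have "even (form x x)"
      unfolding form_def using sym c_diag finite_I by (simp add: d even_form)
    ultimately show ?thesis by (auto elim!: evenE)
  qed
  have "(\<forall>i\<in>I. P i = 0) \<or> (\<forall>i\<in>I. N i = 0)"
    using two[of P] two[of N] le by fastforce
  moreover have "\<beta> k \<le> 0" if "\<forall>i\<in>I. P i = 0" for k
    using that roots_outside[OF \<beta>, of k] by (cases "k \<in> I") (auto simp: P_def max_def split: if_splits)
  moreover have "0 \<le> \<beta> k" if "\<forall>i\<in>I. N i = 0" for k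
    using that roots_outside[OF \<beta>, of k] by (cases "k \<in> I") (auto simp: N_def max_def split: if_splits)
  ultimately show ?thesis by (auto simp: nonneg_def)
qed

text \<open>Here \<open>c\<close> is symmetric, so the real symmetriser is constant along edges,
  hence constant, and can be divided out to give positivity with integer symmetriser 1.\<close>

lemma simply_laced_coherent:
  assumes dyn: "finite_dynkin I c" and sl: "simply_laced I c"
  shows "coherent_cartan I c (\<lambda>_. 1)"
proof -
  have fin: "finite I" and gc: "generalized_cartan I c" and ft: "finite_type I c"
    and conn: "connected_diagram I c"
    using dyn by (auto simp: finite_dynkin_def)
  have c_sym: "c i j = c j i" if "i \<in> I" "j \<in> I" for i j
  proof (cases "i = j")
    case False
    then have "c i j \<in> {0, -1}" "c j i \<in> {0, -1}" "c i j = 0 \<longleftrightarrow> c j i = 0"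
      using that sl gc unfolding simply_laced_def generalized_cartan_def by metis+
    then show ?thesis by auto
  qed simp
  obtain d :: "'a \<Rightarrow> real" where d: "\<And>i. i \<in> I \<Longrightarrow> d i > 0"
    "\<And>i j. i \<in> I \<Longrightarrow> j \<in> I \<Longrightarrow> d i * of_int (c i j) = d j * of_int (c j i)"
    and pos: "\<And>x :: 'a \<Rightarrow> real. \<exists>i\<in>I. x i \<noteq> 0 \<Longrightarrow> (\<Sum>i\<in>I. \<Sum>j\<in>I. d i * of_int (c i j) * x i * x j) > 0"
    using ft unfolding finite_type_def by blast
  obtain i\<^sub>0 where i0: "i\<^sub>0 \<in> I" using conn by (auto simp: connected_diagram_def)
  have d_const: "d i = d i\<^sub>0" if "i \<in> I" for i
  proof -
    have "(i\<^sub>0, i) \<in> {(k, l). k \<in> I \<and> l \<in> I \<and> adjacent c k l}\<^sup>*"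
      using conn i0 that by (auto simp: connected_diagram_def)
    then show ?thesis
    proof (induction rule: rtrancl_induct)
      case (step k l)
      then have "k \<in> I" "l \<in> I" "c k l \<noteq> 0" by (auto simp: adjacent_def)
      then have "d k = d l" using d(2)[of k l] c_sym[of k l] by simp
      then show ?case using step by simp
    qed simp
  qed
  interpret cartan_form I c "\<lambda>_. 1"
  proof
    fix x :: "'a \<Rightarrow> int" assume "\<exists>i\<in>I. x i \<noteq> 0"
    then have "0 < (\<Sum>i\<in>I. \<Sum>j\<in>I. d i * of_int (c i j) * of_int (x i) * of_int (x j))"
      by (intro pos) auto
    also have "\<dots> = (\<Sum>i\<in>I. \<Sum>j\<in>I. d i\<^sub>0 * of_int (c i j * x i * x j))"
      by (simp add: d_const mult.assoc)
    also have "\<dots> = d i\<^sub>0 * of_int (\<Sum>i\<in>I. \<Sum>j\<in>I. c i j * x i * x j)"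
      by (simp only: of_int_sum sum_distrib_left)
    finally have "0 < d i\<^sub>0 * of_int (\<Sum>i\<in>I. \<Sum>j\<in>I. c i j * x i * x j)" .
    then have "(0 :: real) < of_int (\<Sum>i\<in>I. \<Sum>j\<in>I. c i j * x i * x j)"
      using d(1)[OF i0] by (rule zero_less_mult_pos)
    then show "0 < (\<Sum>i\<in>I. \<Sum>j\<in>I. 1 * c i j * x i * x j)"
      by (simp only: of_int_0_less_iff mult_1)
  qed (use fin gc c_sym in \<open>auto simp: generalized_cartan_def\<close>)
  show ?thesis
    by unfold_locales (rule roots_coherent[OF refl])
qed

subsection \<open>Folding\<close>

text \<open>The fixed vertex normalises the folded form; nonadjacency within orbits makes the folded
  diagonal entries equal to 2 and the reflections of one orbit commute.\<close>

locale folding = coherent_cartan I c "\<lambda>_. 1"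
  for I :: "'a set" and c :: "'a \<Rightarrow> 'a \<Rightarrow> int" +
  fixes \<sigma> :: "'a \<Rightarrow> 'a"
  assumes perm: "\<sigma> permutes I"
    and aut: "i \<in> I \<Longrightarrow> j \<in> I \<Longrightarrow> c (\<sigma> i) (\<sigma> j) = c i j"
    and conn: "connected_diagram I c"
    and fixed_vertex: "\<exists>i\<in>I. \<sigma> i = i"
    and orbit_nonadjacent: "i \<in> I \<Longrightarrow> j \<in> orbit \<sigma> i \<Longrightarrow> \<not> adjacent c i j"
begin

abbreviation "V \<equiv> fold_vertices I \<sigma>"
abbreviation "C \<equiv> fold_cartan I c \<sigma>"
abbreviation "d\<^sub>V p \<equiv> int (card p)"

lemma c_sym: "i \<in> I \<Longrightarrow> j \<in> I \<Longrightarrow> c i j = c j i"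
  using d_sym[of i j] by simp

lemma permutation_\<sigma>: "permutation \<sigma>"
  using perm finite_I permutation_permutes by blast

lemma in_orbit_self: "i \<in> orbit \<sigma> i"
  using permutation_\<sigma> by (rule permutation_self_in_orbit)

lemma \<sigma>_in_I [simp]: "\<sigma> i \<in> I \<longleftrightarrow> i \<in> I"
  using permutes_in_image[OF perm] .

lemma orbit_eq: "j \<in> orbit \<sigma> i \<Longrightarrow> orbit \<sigma> j = orbit \<sigma> i"
  by (induction rule: orbit.induct) (simp_all add: permutation_orbit_step[OF permutation_\<sigma>])

lemma orbit_\<sigma> [simp]: "orbit \<sigma> (\<sigma> i) = orbit \<sigma> i"
  by (rule permutation_orbit_step[OF permutation_\<sigma>])

lemma orbit_subset_I:
  assumes "i \<in> I"
  shows "orbit \<sigma> i \<subseteq> I"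
proof
  fix j assume "j \<in> orbit \<sigma> i"
  then show "j \<in> I" using assms by induction simp_all
qed

lemma V_memE:
  assumes "p \<in> V"
  obtains i where "i \<in> I" "p = orbit \<sigma> i"
  using assms unfolding fold_vertices_def by blast

lemma orbit_in_V: "i \<in> I \<Longrightarrow> orbit \<sigma> i \<in> V"
  by (simp add: fold_vertices_def)

lemma V_subset_I: "p \<in> V \<Longrightarrow> p \<subseteq> I"
  using orbit_subset_I by (elim V_memE) simp

lemma in_V_iff: "p \<in> V \<Longrightarrow> i \<in> p \<longleftrightarrow> i \<in> I \<and> orbit \<sigma> i = p"
proof -
  assume "p \<in> V"
  moreover from this obtain j where "j \<in> I" "p = orbit \<sigma> j" by (rule V_memE)
  ultimately show "i \<in> p \<longleftrightarrow> i \<in> I \<and> orbit \<sigma> i = p"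
    using V_subset_I[of p] in_orbit_self[of i] orbit_eq[of i j] by auto
qed

lemma fibre_eq: "p \<in> V \<Longrightarrow> fold_fibre I \<sigma> p = p"
  using in_V_iff[of p] by (auto simp: fold_fibre_def)

lemma V_nonempty: "p \<in> V \<Longrightarrow> p \<noteq> {}"
  using in_orbit_self by (elim V_memE) blast

lemma finite_V_mem: "p \<in> V \<Longrightarrow> finite p"
  using V_subset_I finite_I finite_subset by blast

lemma finite_V: "finite V"
  using finite_I by (simp add: fold_vertices_def)

lemma card_V_pos: "p \<in> V \<Longrightarrow> 0 < card p"
  using V_nonempty finite_V_mem by (simp add: card_gt_0_iff)

lemma \<sigma>_in_V_mem: "p \<in> V \<Longrightarrow> \<sigma> i \<in> p \<longleftrightarrow> i \<in> p"
  by (simp add: in_V_iff)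

lemma bij_\<sigma>_V_mem: "p \<in> V \<Longrightarrow> bij_betw \<sigma> p p"
proof -
  assume p: "p \<in> V"
  have "\<sigma> ` p \<subseteq> p" using p by (auto simp: \<sigma>_in_V_mem)
  moreover have "inj_on \<sigma> p" using permutes_inj[OF perm] by (rule inj_on_subset) simp
  ultimately show ?thesis
    using finite_V_mem[OF p] by (simp add: bij_betw_def endo_inj_surj)
qed

lemma sum_\<sigma>: "p \<in> V \<Longrightarrow> (\<Sum>j\<in>p. g (\<sigma> j)) = (\<Sum>j\<in>p. g j)"
  by (rule sum.reindex_bij_betw[OF bij_\<sigma>_V_mem])

lemma orbit_invariant:
  assumes "\<And>i. i \<in> I \<Longrightarrow> g (\<sigma> i) = g i" "p \<in> V" "i \<in> p" "j \<in> p"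
  shows "g i = g j"
proof -
  have "i \<in> I" "j \<in> orbit \<sigma> i" using assms in_V_iff in_orbit_self by auto
  from this(2,1) show ?thesis
  proof (induction)
    case (step y)
    then have "y \<in> I" using orbit_subset_I by blast
    then show ?case using assms(1)[of y] step by simp
  qed (use assms(1) in simp)
qed

lemma sum_orbits: "(\<Sum>i\<in>I. g i) = (\<Sum>p\<in>V. \<Sum>i\<in>p. g i)"
proof -
  have "(\<Sum>i\<in>I. g i) = (\<Sum>p\<in>V. \<Sum>i\<in>{i \<in> I. orbit \<sigma> i = p}. g i)"
    unfolding fold_vertices_def by (rule sum.image_gen[OF finite_I])
  also have "\<dots> = (\<Sum>p\<in>V. \<Sum>i\<in>p. g i)"
    using fibre_eq by (intro sum.cong) (auto simp: fold_fibre_def)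
  finally show ?thesis .
qed

text \<open>Removes the arbitrary choice of representative: the row sum over an orbit is
  \<sigma>-invariant.\<close>

lemma fold_cartan_eq:
  assumes "p \<in> V" "q \<in> V" "i \<in> p"
  shows "C p q = (\<Sum>j\<in>q. c i j)"
proof -
  have inv: "(\<Sum>j\<in>q. c (\<sigma> i) j) = (\<Sum>j\<in>q. c i j)" if "i \<in> I" for i
  proof -
    have "(\<Sum>j\<in>q. c (\<sigma> i) j) = (\<Sum>j\<in>q. c (\<sigma> i) (\<sigma> j))" by (simp add: sum_\<sigma>[OF assms(2)])
    also have "\<dots> = (\<Sum>j\<in>q. c i j)"
      using V_subset_I[OF assms(2)] that by (intro sum.cong) (auto intro: aut)
    finally show ?thesis .
  qed
  have "(SOME i. i \<in> p) \<in> p" using assms(3) by (rule someI)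
  from orbit_invariant[where g = "\<lambda>i. \<Sum>j\<in>q. c i j", OF inv assms(1) this assms(3)]
  show ?thesis using assms by (simp add: fold_cartan_def fibre_eq)
qed

text \<open>A block sum of the symmetric matrix \<open>c\<close> is symmetric in \<open>p\<close>
  and \<open>q\<close>, which exhibits orbit sizes as symmetriser.\<close>

lemma card_fold_cartan:
  assumes "p \<in> V" "q \<in> V"
  shows "d\<^sub>V p * C p q = (\<Sum>i\<in>p. \<Sum>j\<in>q. c i j)"
proof -
  have "(\<Sum>i\<in>p. \<Sum>j\<in>q. c i j) = (\<Sum>i\<in>p. C p q)"
    using assms by (intro sum.cong refl) (simp add: fold_cartan_eq)
  then show ?thesis by simp
qed

lemma c_orbit:
  assumes "p \<in> V" "i \<in> p" "j \<in> p" "j \<noteq> i"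
  shows "c i j = 0"
  using assms orbit_nonadjacent[of i j] by (auto simp: in_V_iff adjacent_def)

text \<open>Positivity holds because the folded form at \<open>x\<close> is the form of \<triangle>
  at the orbit-constant extension of \<open>x\<close>, regrouped into blocks.\<close>

lemma cartan_form_fold: "cartan_form V C d\<^sub>V"
proof
  fix p assume p: "p \<in> V"
  then obtain i where i: "i \<in> p" using V_nonempty by blast
  then have "i \<in> I" using p V_subset_I by blast
  have "C p p = (\<Sum>j\<in>p. c i j)" using p i by (simp add: fold_cartan_eq)
  also have "\<dots> = c i i + (\<Sum>j\<in>p - {i}. c i j)" using p i finite_V_mem by (intro sum.remove)
  also have "(\<Sum>j\<in>p - {i}. c i j) = 0" using p i by (intro sum.neutral) (auto intro: c_orbit)
  finally show "C p p = 2" using c_diag \<open>i \<in> I\<close> by simp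
next
  fix p q assume pq: "p \<in> V" "q \<in> V" "p \<noteq> q"
  then obtain i where i: "i \<in> p" using V_nonempty by blast
  have "C p q = (\<Sum>j\<in>q. c i j)" using pq i by (simp add: fold_cartan_eq)
  also have "\<dots> \<le> 0" using pq i by (intro sum_nonpos c_nonpos) (auto simp: in_V_iff)
  finally show "C p q \<le> 0" .
next
  fix p q assume pq: "p \<in> V" "q \<in> V"
  have "d\<^sub>V p * C p q = (\<Sum>i\<in>p. \<Sum>j\<in>q. c i j)" using pq by (rule card_fold_cartan)
  also have "\<dots> = (\<Sum>i\<in>p. \<Sum>j\<in>q. c j i)"
    using pq c_sym V_subset_I by (intro sum.cong refl) blast
  also have "\<dots> = (\<Sum>j\<in>q. \<Sum>i\<in>p. c j i)" by (rule sum.swap)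
  also have "\<dots> = d\<^sub>V q * C q p" using pq by (simp add: card_fold_cartan)
  finally show "d\<^sub>V p * C p q = d\<^sub>V q * C q p" .
next
  fix x :: "'a set \<Rightarrow> int" assume "\<exists>p\<in>V. x p \<noteq> 0"
  then obtain i where "i \<in> I" "x (orbit \<sigma> i) \<noteq> 0" by (auto elim: V_memE)
  then have "0 < (\<Sum>i\<in>I. \<Sum>j\<in>I. 1 * c i j * x (orbit \<sigma> i) * x (orbit \<sigma> j))"
    by (intro form_pos) blast
  also have "\<dots> = (\<Sum>p\<in>V. \<Sum>i\<in>p. \<Sum>q\<in>V. \<Sum>j\<in>q. c i j * x (orbit \<sigma> i) * x (orbit \<sigma> j))"
    by (simp add: sum_orbits)
  also have "\<dots> = (\<Sum>p\<in>V. \<Sum>q\<in>V. \<Sum>i\<in>p. \<Sum>j\<in>q. c i j * x (orbit \<sigma> i) * x (orbit \<sigma> j))"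
    by (intro sum.cong refl sum.swap)
  also have "\<dots> = (\<Sum>p\<in>V. \<Sum>q\<in>V. d\<^sub>V p * C p q * x p * x q)"
  proof (intro sum.cong refl)
    fix p q assume pq: "p \<in> V" "q \<in> V"
    have "(\<Sum>i\<in>p. \<Sum>j\<in>q. c i j * x (orbit \<sigma> i) * x (orbit \<sigma> j)) = (\<Sum>i\<in>p. \<Sum>j\<in>q. c i j * (x p * x q))"
      using pq in_V_iff by (intro sum.cong refl) (simp add: mult.assoc)
    also have "\<dots> = d\<^sub>V p * C p q * x p * x q"
      using pq by (simp add: card_fold_cartan sum_distrib_right mult.assoc)
    finally show "(\<Sum>i\<in>p. \<Sum>j\<in>q. c i j * x (orbit \<sigma> i) * x (orbit \<sigma> j)) = d\<^sub>V p * C p q * x p * x q" .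
  qed
  finally show "0 < (\<Sum>p\<in>V. \<Sum>q\<in>V. d\<^sub>V p * C p q * x p * x q)" .
qed (use finite_V card_V_pos in auto)

sublocale fold: cartan_form V C "\<lambda>p. d\<^sub>V p"
  by (rule cartan_form_fold)

section \<open>Lifting Weyl group words from the folding\<close>

definition lift :: "('a set \<Rightarrow> int) \<Rightarrow> 'a \<Rightarrow> int" where
  "lift \<beta> = (\<lambda>i. if i \<in> I then \<beta> (orbit \<sigma> i) else 0)"

text \<open>Any enumeration serves, since the reflections of an orbit commute.\<close>

definition orbit_word :: "'a set \<Rightarrow> 'a list" where
  "orbit_word p = (SOME xs. distinct xs \<and> set xs = p)"

definition lift_word :: "'a set list \<Rightarrow> 'a list" where
  "lift_word ps = concat (map orbit_word ps)"

lemma orbit_word: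
  assumes "p \<in> V"
  shows "distinct (orbit_word p)" "set (orbit_word p) = p"
proof -
  have "\<exists>xs. distinct xs \<and> set xs = p" using finite_V_mem[OF assms] finite_distinct_list by blast
  then have "distinct (orbit_word p) \<and> set (orbit_word p) = p"
    unfolding orbit_word_def by (rule someI_ex)
  then show "distinct (orbit_word p)" "set (orbit_word p) = p" by simp_all
qed

lemma set_lift_word: "set ps \<subseteq> V \<Longrightarrow> set (lift_word ps) = \<Union> (set ps)"
  by (induction ps) (auto simp: lift_word_def orbit_word)

lemma set_lift_word_subset: "set ps \<subseteq> V \<Longrightarrow> set (lift_word ps) \<subseteq> I"
  using V_subset_I by (auto simp: set_lift_word)

lemma lift_word_Cons: "lift_word (p # ps) = orbit_word p @ lift_word ps"
  by (simp add: lift_word_def)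

lemma distinct_lift_word: "distinct ps \<Longrightarrow> set ps \<subseteq> V \<Longrightarrow> distinct (lift_word ps)"
proof (induction ps)
  case (Cons p ps)
  have "p \<inter> q = {}" if "q \<in> set ps" for q
  proof -
    have "p \<in> V" "q \<in> V" "p \<noteq> q" using Cons.prems that by auto
    then show ?thesis by (auto simp: in_V_iff)
  qed
  then have "p \<inter> \<Union> (set ps) = {}" by blast
  then show ?case using Cons by (simp add: lift_word_Cons orbit_word set_lift_word)
qed (simp add: lift_word_def)

text \<open>A reflection changes only its own coordinate, which no other letter pairs with. So every
  letter subtracts its pairing with the original \<beta>.\<close>

lemma word_action_commuting:
  assumes "distinct ys" "set ys \<subseteq> I" "\<And>a b. a \<in> set ys \<Longrightarrow> b \<in> set ys \<Longrightarrow> a \<noteq> b \<Longrightarrow> c a b = 0"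
  shows "word_action I c ys \<beta> k = \<beta> k - (if k \<in> set ys then pairing I c k \<beta> else 0)"
  using assms
proof (induction ys arbitrary: k)
  case (Cons a ys)
  have IH: "word_action I c ys \<beta> k = \<beta> k - (if k \<in> set ys then pairing I c k \<beta> else 0)" for k
    using Cons by simp
  have "pairing I c a (word_action I c ys \<beta>) = pairing I c a \<beta>"
    unfolding pairing_def
  proof (rule sum.cong[OF refl])
    fix j assume "j \<in> I"
    show "word_action I c ys \<beta> j * c a j = \<beta> j * c a j"
    proof (cases "j \<in> set ys")
      case True
      then have "c a j = 0" using Cons.prems by auto
      then show ?thesis by simp
    qed (simp add: IH)
  qed
  then show ?case
    using Cons.prems(1) by (simp add: reflection_eq IH simple_root_def)
qed simp

lemma orbit_word_action:
  assumes "p \<in> V"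
  shows "word_action I c (orbit_word p) \<beta> k = \<beta> k - (if k \<in> p then pairing I c k \<beta> else 0)"
  using word_action_commuting[of "orbit_word p"] orbit_word[OF assms] V_subset_I[OF assms] c_orbit[OF assms]
  by simp

text \<open>For \<open>k\<close> in \<open>p\<close>, grouping the pairing with a lifted vector by
  orbits gives the folded pairing at \<open>p\<close>. The word of the orbit subtracts this common
  value at all members of \<open>p\<close>, exactly as s_p does below.\<close>

lemma word_action_lift:
  assumes "set ps \<subseteq> V"
  shows "word_action I c (lift_word ps) (lift \<beta>) = lift (word_action V C ps \<beta>)"
  using assms
proof (induction ps)
  case (Cons p ps)
  define \<gamma> where "\<gamma> = word_action V C ps \<beta>"
  have p: "p \<in> V" using Cons.prems by simp
  have pair: "pairing I c k (lift \<gamma>) = pairing V C p \<gamma>" if k: "k \<in> p" for k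
  proof -
    have "pairing I c k (lift \<gamma>) = (\<Sum>q\<in>V. \<Sum>j\<in>q. lift \<gamma> j * c k j)"
      by (simp add: pairing_def sum_orbits)
    also have "\<dots> = (\<Sum>q\<in>V. \<Sum>j\<in>q. \<gamma> q * c k j)"
      by (intro sum.cong refl) (simp add: lift_def in_V_iff)
    also have "\<dots> = pairing V C p \<gamma>"
      using p k by (simp add: pairing_def fold_cartan_eq sum_distrib_left)
    finally show ?thesis .
  qed
  have "word_action I c (orbit_word p) (lift \<gamma>) = lift (reflection V C p \<gamma>)"
  proof
    fix k
    show "word_action I c (orbit_word p) (lift \<gamma>) k = lift (reflection V C p \<gamma>) k"
      using p pair[of k] in_V_iff[OF p, of k]
      by (auto simp: orbit_word_action lift_def reflection_eq simple_root_def)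
  qed
  then show ?case
    using Cons by (simp add: lift_word_Cons word_action_append \<gamma>_def)
qed (simp add: lift_word_def)

lemma word_action_\<sigma>:
  assumes "set ps \<subseteq> V"
  shows "word_action I c (lift_word ps) (\<beta> \<circ> \<sigma>) = word_action I c (lift_word ps) \<beta> \<circ> \<sigma>"
  using assms
proof (induction ps)
  case (Cons p ps)
  have p: "p \<in> V" using Cons.prems by simp
  have pair: "pairing I c k (\<gamma> \<circ> \<sigma>) = pairing I c (\<sigma> k) \<gamma>" if "k \<in> I" for k \<gamma>
  proof -
    have "pairing I c k (\<gamma> \<circ> \<sigma>) = (\<Sum>j\<in>I. \<gamma> (\<sigma> j) * c (\<sigma> k) (\<sigma> j))"
      using that by (simp add: pairing_def aut)
    also have "\<dots> = pairing I c (\<sigma> k) \<gamma>"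
      unfolding pairing_def
      by (rule sum.reindex_bij_betw[OF permutes_imp_bij[OF perm], of "\<lambda>j. \<gamma> j * c (\<sigma> k) j"])
    finally show ?thesis .
  qed
  have "word_action I c (orbit_word p) (\<gamma> \<circ> \<sigma>) = word_action I c (orbit_word p) \<gamma> \<circ> \<sigma>" for \<gamma>
  proof
    fix k
    show "word_action I c (orbit_word p) (\<gamma> \<circ> \<sigma>) k = (word_action I c (orbit_word p) \<gamma> \<circ> \<sigma>) k"
      using pair[of k \<gamma>] V_subset_I[OF p] by (auto simp: orbit_word_action[OF p] \<sigma>_in_V_mem[OF p])
  qed
  moreover have "word_action I c (lift_word (p # ps)) \<gamma>
      = word_action I c (orbit_word p) (word_action I c (lift_word ps) \<gamma>)" for \<gamma>
    by (simp add: lift_word_Cons word_action_append)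
  moreover have "word_action I c (lift_word ps) (\<beta> \<circ> \<sigma>) = word_action I c (lift_word ps) \<beta> \<circ> \<sigma>"
    by (rule Cons.IH) (use Cons.prems in simp)
  ultimately show ?case by (simp only:)
qed (simp add: lift_word_def)

lemma nonneg_\<sigma>: "nonneg (\<beta> \<circ> \<sigma>) \<longleftrightarrow> nonneg \<beta>"
  unfolding nonneg_def comp_def using permutes_surj[OF perm] by (metis surjD)

text \<open>Pullback along \<sigma> commutes with the lifted word, preserves signs and takes
  \<open>simple_root (\<sigma> i)\<close> to \<open>simple_root i\<close>. Hence sums of images over
  an orbit have no cancellation.\<close>

lemma nonneg_orbit:
  assumes ps: "set ps \<subseteq> V" and p: "p \<in> V" "i \<in> p" "j \<in> p"
  shows "nonneg (word_action I c (lift_word ps) (simple_root i))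
     \<longleftrightarrow> nonneg (word_action I c (lift_word ps) (simple_root j))"
proof (rule orbit_invariant[OF _ p])
  fix i assume "i \<in> I"
  have "simple_root (\<sigma> i) \<circ> \<sigma> = simple_root i"
    using permutes_inj[OF perm] by (auto simp: simple_root_def fun_eq_iff inj_eq)
  then show "nonneg (word_action I c (lift_word ps) (simple_root (\<sigma> i)))
      = nonneg (word_action I c (lift_word ps) (simple_root i))"
    using word_action_\<sigma>[OF ps, of "simple_root (\<sigma> i)"] nonneg_\<sigma> by metis
qed

lemma lift_simple_root:
  assumes "p \<in> V"
  shows "lift (simple_root p) = (\<lambda>k. \<Sum>i\<in>p. 1 * simple_root i k)"
proof
  fix k
  have "(\<Sum>i\<in>p. 1 * simple_root i k) = (\<Sum>i\<in>p. if i = k then 1 else 0 :: int)"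
    by (intro sum.cong) (auto simp: simple_root_def)
  then show "lift (simple_root p) k = (\<Sum>i\<in>p. 1 * simple_root i k)"
    using in_V_iff[OF assms, of k] finite_V_mem[OF assms] by (simp add: lift_def simple_root_def)
qed

lemma lift_word_action_simple_root:
  assumes "set ps \<subseteq> V" "p \<in> V"
  shows "lift (word_action V C ps (simple_root p)) k
    = (\<Sum>i\<in>p. word_action I c (lift_word ps) (simple_root i) k)"
  unfolding word_action_lift[OF assms(1), symmetric] lift_simple_root[OF assms(2)] word_action_sum
  by simp

lemma lift_orbit: "p \<in> V \<Longrightarrow> i \<in> p \<Longrightarrow> lift \<beta> i = \<beta> p"
  by (simp add: lift_def in_V_iff)

text \<open>Each coordinate of a folded root is a sum over one orbit of coordinates of roots of
  equal sign.\<close>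

sublocale fold: coherent_cartan V C "\<lambda>p. d\<^sub>V p"
proof
  fix \<beta> assume \<beta>: "\<beta> \<in> roots V C"
  then obtain ps p where ps: "set ps \<subseteq> V" "p \<in> V" "\<beta> = word_action V C ps (simple_root p)"
    by (rule rootsE)
  let ?w = "word_action I c (lift_word ps)"
  obtain i where i: "i \<in> p" using V_nonempty ps by blast
  have root: "?w (simple_root j) \<in> roots I c" if "j \<in> p" for j
    using that ps V_subset_I set_lift_word_subset by (intro rootsI) auto
  have val: "\<beta> q = (\<Sum>j\<in>p. ?w (simple_root j) k)" if "q \<in> V" "k \<in> q" for q k
    using lift_word_action_simple_root[OF ps(1,2), of k] lift_orbit[OF that, of \<beta>] ps(3) by simp
  have out: "\<beta> q = 0" if "q \<notin> V" for q using roots_outside[OF \<beta> that] .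
  show "nonneg \<beta> \<or> nonneg (\<lambda>q. - \<beta> q)"
  proof (cases "nonneg (?w (simple_root i))")
    case True
    then have pos: "0 \<le> ?w (simple_root j) k" if "j \<in> p" for j k
      using nonneg_orbit[OF ps(1,2) i that] by (simp add: nonneg_def)
    have "0 \<le> \<beta> q" for q
    proof (cases "q \<in> V")
      case True
      then obtain k where "k \<in> q" using V_nonempty by blast
      then show ?thesis using val[OF True] pos by (simp add: sum_nonneg)
    qed (simp add: out)
    then show ?thesis by (simp add: nonneg_def)
  next
    case False
    then have neg: "?w (simple_root j) k \<le> 0" if "j \<in> p" for j k
    proof -
      have "nonneg (\<lambda>k. - ?w (simple_root j) k)"
        using False nonneg_orbit[OF ps(1,2) i that] not_nonneg[OF root[OF that]] by simp
      then show ?thesis by (simp add: nonneg_def)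
    qed
    have "\<beta> q \<le> 0" for q
    proof (cases "q \<in> V")
      case True
      then obtain k where "k \<in> q" using V_nonempty by blast
      then show ?thesis using val[OF True] neg by (simp add: sum_nonpos)
    qed (simp add: out)
    then show ?thesis by (simp add: nonneg_def)
  qed
qed

lemma lift_eq_imp:
  assumes "lift \<beta> = lift \<gamma>" "p \<in> V"
  shows "\<beta> p = \<gamma> p"
proof -
  obtain i where "i \<in> p" using V_nonempty[OF assms(2)] by blast
  then show ?thesis using lift_orbit[OF assms(2)] assms(1) by metis
qed

text \<open>Triviality on invariant vectors alone must be shown to imply triviality. If the lift
  made \<alpha>_i negative, it would make the whole orbit negative; but these images sum to the lift
  of \<alpha>_p, whose coordinate at \<open>i\<close> is 1.\<close>

lemma lift_word_id_iff:
  assumes ps: "set ps \<subseteq> V"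
  shows "word_action V C ps = id \<longleftrightarrow> word_action I c (lift_word ps) = id"
proof
  assume id: "word_action I c (lift_word ps) = id"
  show "word_action V C ps = id"
  proof (intro ext)
    fix \<beta> p
    show "word_action V C ps \<beta> p = id \<beta> p"
    proof (cases "p \<in> V")
      case True
      then show ?thesis using lift_eq_imp[of "word_action V C ps \<beta>" \<beta> p] word_action_lift[OF ps, of \<beta>] id
        by simp
    qed (use ps in \<open>simp add: word_action_outside\<close>)
  qed
next
  assume id: "word_action V C ps = id"
  show "word_action I c (lift_word ps) = id"
  proof (rule word_action_eq_id[OF set_lift_word_subset[OF ps]])
    fix i assume i: "i \<in> I"
    let ?w = "word_action I c (lift_word ps)" and ?p = "orbit \<sigma> i"
    have p: "?p \<in> V" "i \<in> ?p" using i orbit_in_V in_orbit_self by auto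
    show "nonneg (?w (simple_root i))"
    proof (rule ccontr)
      assume neg: "\<not> ?thesis"
      have le: "?w (simple_root j) i \<le> 0" if j: "j \<in> ?p" for j
      proof -
        have "?w (simple_root j) \<in> roots I c"
          using j p V_subset_I set_lift_word_subset[OF ps] by (intro rootsI) auto
        moreover have "\<not> nonneg (?w (simple_root j))" using neg nonneg_orbit[OF ps p j] by simp
        ultimately show ?thesis using not_nonneg by (simp add: nonneg_def)
      qed
      have "lift (simple_root ?p) i = (\<Sum>j\<in>?p. ?w (simple_root j) i)"
        using lift_word_action_simple_root[OF ps p(1), of i] id by simp
      also have "\<dots> \<le> 0" using le by (rule sum_nonpos)
      finally show False using i by (simp add: lift_def)
    qed
  qed
qed

section \<open>Coxeter number, involution and half norms of the folding\<close>

lemma word_action_funpow: "word_action J b xs ^^ n = word_action J b (concat (replicate n xs))"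
  by (induction n) (simp_all add: word_action_append)

lemma lift_word_concat: "lift_word (concat pss) = concat (map lift_word pss)"
  by (induction pss) (simp_all add: lift_word_def)

text \<open>The orbit words of all orbits together enumerate \<open>I\<close>, so a Coxeter word
  lifts to a Coxeter word. Powers are again words, and lifting preserves and reflects
  triviality.\<close>

lemma coxeter_number_fold: "coxeter_number V C = coxeter_number I c"
proof -
  obtain ps where ps: "distinct ps" "set ps = V" using finite_V finite_distinct_list by blast
  have UV: "\<Union> V = I" using V_subset_I orbit_in_V in_orbit_self by blast
  have "(word_action V C ps ^^ n = id) \<longleftrightarrow> (word_action I c (lift_word ps) ^^ n = id)" for n
  proof -
    have "set (concat (replicate n ps)) \<subseteq> V" using ps by auto
    from lift_word_id_iff[OF this] show ?thesis
      by (simp only: word_action_funpow lift_word_concat map_replicate)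
  qed
  moreover have "coxeter_number V C = (LEAST n. n > 0 \<and> (word_action V C ps ^^ n) = id)"
    using ps by (rule fold.coxeter_number_eq)
  moreover have "coxeter_number I c = (LEAST n. n > 0 \<and> (word_action I c (lift_word ps) ^^ n) = id)"
    using ps UV by (intro coxeter_number_eq) (simp_all add: distinct_lift_word set_lift_word)
  ultimately show ?thesis by simp
qed

text \<open>Once the lift of the folded longest element is known to be w_0, the sum of w_0
  \<alpha>_i over \<open>p\<close> has two expressions: minus the indicator of the orbit p*, and
  minus the sum of the \<alpha>_{i*}. Their supports agree.\<close>

lemma dynkin_star_fold:
  assumes p: "p \<in> V"
  shows "dynkin_star V C p = dynkin_star I c ` p"
proof -
  obtain ps where ps: "set ps \<subseteq> V" "longest_element V C = word_action V C ps"
    by (rule fold.longest_element)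
  let ?w = "word_action I c (lift_word ps)"
  have sum: "(\<Sum>i\<in>q. ?w (simple_root i) k) = (if k \<in> dynkin_star V C q then -1 else 0)"
    if q: "q \<in> V" for q k
  proof -
    have star: "dynkin_star V C q \<in> V" using q by (rule fold.dynkin_star(1))
    have "word_action V C ps (simple_root q) = (\<lambda>k. - simple_root (dynkin_star V C q) k)"
      using fold.dynkin_star(2)[OF q] by (simp only: ps(2))
    then have "(\<Sum>i\<in>q. ?w (simple_root i) k) = lift (\<lambda>k. - simple_root (dynkin_star V C q) k) k"
      using lift_word_action_simple_root[OF ps(1) q, of k] by simp
    then show ?thesis
      using in_V_iff[OF star, of k] by (simp add: lift_def simple_root_def)
  qed
  have sub: "set (lift_word ps) \<subseteq> I" using ps by (intro set_lift_word_subset)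
  have "negates ?w"
    unfolding negates_def
  proof (intro ballI, rule ccontr)
    fix i assume i: "i \<in> I" "\<not> nonneg (\<lambda>k. - ?w (simple_root i) k)"
    define q where "q = orbit \<sigma> i"
    have q: "q \<in> V" "i \<in> q" using i orbit_in_V in_orbit_self by (auto simp: q_def)
    have "nonneg (?w (simple_root i))" using i(2) not_nonneg[OF rootsI[OF sub i(1)]] by blast
    then have pos: "0 \<le> ?w (simple_root j) k" if "j \<in> q" for j k
      using nonneg_orbit[OF ps(1) q that] by (simp add: nonneg_def)
    \<comment> \<open>Any member of q* gives the contradiction: the images of \<open>q\<close> sum
      to -1 there, while positive images would give at least 0.\<close>
    obtain k where k: "k \<in> dynkin_star V C q" using fold.dynkin_star(1)[OF q(1)] V_nonempty by blast
    have "0 \<le> (\<Sum>j\<in>q. ?w (simple_root j) k)" using pos by (rule sum_nonneg)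
    then show False using sum[OF q(1), of k] k by simp
  qed
  moreover obtain xs where "set xs \<subseteq> I" "longest_element I c = word_action I c xs"
    "negates (word_action I c xs)" by (rule longest_element)
  ultimately have w: "longest_element I c = ?w" using negates_unique sub by simp
  have "(\<Sum>i\<in>p. ?w (simple_root i) k) = - (\<Sum>i\<in>p. if k = dynkin_star I c i then 1 else 0)" for k
    unfolding sum_negf[symmetric]
    using dynkin_star(2) V_subset_I[OF p] w by (intro sum.cong refl) (auto simp: simple_root_def)
  then have eq: "(\<Sum>i\<in>p. if k = dynkin_star I c i then 1 else 0 :: int) = (if k \<in> dynkin_star V C p then 1 else 0)"
    for k using sum[OF p, of k] by (auto split: if_splits)
  have "k \<in> dynkin_star V C p \<longleftrightarrow> (\<exists>i\<in>p. k = dynkin_star I c i)" for k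
  proof -
    have "(\<Sum>i\<in>p. if k = dynkin_star I c i then 1 else 0 :: int) = 0
      \<longleftrightarrow> (\<forall>i\<in>p. (if k = dynkin_star I c i then 1 else 0 :: int) = 0)"
      using finite_V_mem[OF p] by (intro sum_nonneg_eq_0_iff) auto
    then show ?thesis using eq[of k] by (auto split: if_splits)
  qed
  then show ?thesis by blast
qed

text \<open>An edge between distinct orbits survives because the block entries are all nonpositive
  and cannot cancel.\<close>

lemma connected_fold: "connected_diagram V C"
proof -
  let ?E = "{(k, l). k \<in> I \<and> l \<in> I \<and> adjacent c k l}"
  let ?F = "{(p, q). p \<in> V \<and> q \<in> V \<and> adjacent C p q}"
  have path: "(orbit \<sigma> i, orbit \<sigma> j) \<in> ?F\<^sup>*" if "(i, j) \<in> ?E\<^sup>*" for i j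
    using that
  proof (induction rule: rtrancl_induct)
    case (step j k)
    show ?case
    proof (cases "orbit \<sigma> j = orbit \<sigma> k")
      case False
      have jk: "j \<in> I" "k \<in> I" "adjacent c j k" using step by auto
      let ?p = "orbit \<sigma> j" and ?q = "orbit \<sigma> k"
      have pq: "?p \<in> V" "?q \<in> V" "j \<in> ?p" "k \<in> ?q" using jk orbit_in_V in_orbit_self by auto
      have "C ?p ?q = (\<Sum>l\<in>?q. c j l)" using pq by (intro fold_cartan_eq)
      also have "\<dots> = c j k + (\<Sum>l\<in>?q - {k}. c j l)" using pq finite_V_mem by (intro sum.remove)
      also have "(\<Sum>l\<in>?q - {k}. c j l) \<le> 0"
        using False pq jk by (intro sum_nonpos c_nonpos) (auto simp: in_V_iff)
      finally have "C ?p ?q \<le> c j k" by simp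
      moreover have "c j k < 0" using jk c_nonpos[of j k] by (auto simp: adjacent_def less_le)
      ultimately have "(?p, ?q) \<in> ?F" using pq False by (simp add: adjacent_def)
      then show ?thesis using step.IH by (rule_tac rtrancl.rtrancl_into_rtrancl)
    qed (use step in simp)
  qed simp
  have "V \<noteq> {}" using conn by (auto simp: connected_diagram_def fold_vertices_def)
  moreover have "(p, q) \<in> ?F\<^sup>*" if pq: "p \<in> V" "q \<in> V" for p q
  proof -
    obtain i j where "i \<in> I" "p = orbit \<sigma> i" "j \<in> I" "q = orbit \<sigma> j" using pq by (auto elim!: V_memE)
    then show ?thesis using path conn by (simp add: connected_diagram_def)
  qed
  ultimately show ?thesis by (simp add: connected_diagram_def)
qed

lemma half_norm_fold: "p \<in> V \<Longrightarrow> half_norm V C p = of_nat (card p)"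
proof -
  assume p: "p \<in> V"
  obtain i where i: "i \<in> I" "\<sigma> i = i" using fixed_vertex by blast
  have "j = i" if "j \<in> orbit \<sigma> i" for j
    using that by induction (simp_all add: i)
  then have "orbit \<sigma> i = {i}" using in_orbit_self by blast
  then have "d\<^sub>V (orbit \<sigma> i) = 1" by simp
  then show ?thesis using fold.half_norm_eq[OF connected_fold _ p] orbit_in_V[OF i(1)] by fastforce
qed

lemma half_norm_unfolded: "i \<in> I \<Longrightarrow> half_norm I c i = 1"
  using half_norm_eq[OF conn] fixed_vertex by auto

end

subsection \<open>Inverting symmetric matrices of Laurent series\<close>

lemma left_inverse_eq_right_inverse_on:
  fixes M :: "'a \<Rightarrow> 'a \<Rightarrow> 'b :: field"
  assumes fin: "finite I" and ij: "i \<in> I" "j \<in> I"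
    and L: "\<And>i j. i \<in> I \<Longrightarrow> j \<in> I \<Longrightarrow> (\<Sum>k\<in>I. L i k * M k j) = (if i = j then 1 else 0)"
    and R: "\<And>i j. i \<in> I \<Longrightarrow> j \<in> I \<Longrightarrow> (\<Sum>k\<in>I. M i k * R k j) = (if i = j then 1 else 0)"
  shows "L i j = R i j"
proof -
  have "L i j = (\<Sum>k\<in>I. L i k * (\<Sum>l\<in>I. M k l * R l j))"
    using fin ij by (simp add: R if_distrib cong: if_cong)
  also have "\<dots> = (\<Sum>l\<in>I. (\<Sum>k\<in>I. L i k * M k l) * R l j)"
    by (simp add: sum_distrib_left sum_distrib_right mult.assoc) (rule sum.swap)
  also have "\<dots> = R i j"
    using fin ij by (simp add: L if_distrib if_distribR cong: if_cong)
  finally show ?thesis .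
qed

text \<open>The transpose of a right inverse of a symmetric matrix is a left inverse, and therefore
  equals the right inverse.\<close>

lemma symmetric_right_inverse_imp_left:
  fixes M :: "'a \<Rightarrow> 'a \<Rightarrow> 'b :: field"
  assumes fin: "finite I" and sym: "\<And>i j. i \<in> I \<Longrightarrow> j \<in> I \<Longrightarrow> M i j = M j i"
    and R: "\<And>i j. i \<in> I \<Longrightarrow> j \<in> I \<Longrightarrow> (\<Sum>k\<in>I. M i k * N k j) = (if i = j then 1 else 0)"
    and ij: "i \<in> I" "j \<in> I"
  shows "(\<Sum>k\<in>I. N i k * M k j) = (if i = j then 1 else 0)"
proof -
  have L: "(\<Sum>k\<in>I. N k i * M k j) = (if i = j then 1 else 0)" if "i \<in> I" "j \<in> I" for i j
  proof -
    have "(\<Sum>k\<in>I. N k i * M k j) = (\<Sum>k\<in>I. M j k * N k i)"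
      using that sym by (intro sum.cong refl) (simp add: mult.commute)
    then show ?thesis using R[OF that(2,1)] by auto
  qed
  have N_sym: "N j i = N i j" if "i \<in> I" "j \<in> I" for i j
    by (rule left_inverse_eq_right_inverse_on[of I i j "\<lambda>i j. N j i" M N, OF fin that L R])
  show "(\<Sum>k\<in>I. N i k * M k j) = (if i = j then 1 else 0)"
    unfolding L[OF ij, symmetric] using N_sym ij by (intro sum.cong refl) simp
qed

lemma matrix_inverse_on_eq:
  fixes M :: "'a \<Rightarrow> 'a \<Rightarrow> 'b :: field"
  assumes fin: "finite I" and sym: "\<And>i j. i \<in> I \<Longrightarrow> j \<in> I \<Longrightarrow> M i j = M j i"
    and R: "\<And>i j. i \<in> I \<Longrightarrow> j \<in> I \<Longrightarrow> (\<Sum>k\<in>I. M i k * N k j) = (if i = j then 1 else 0)"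
    and ij: "i \<in> I" "j \<in> I"
  shows "matrix_inverse_on I M i j = N i j"
proof -
  \<comment> \<open>Cut off outside \<open>I\<close> to meet the third clause of
    \<open>matrix_inverse_on\<close>.\<close>
  define N' where "N' i j = (if i \<in> I \<and> j \<in> I then N i j else 0)" for i j
  have "matrix_inverse_on I M = N'"
    unfolding matrix_inverse_on_def
  proof (rule the_equality, intro conjI ballI allI impI)
    fix i j assume "i \<in> I" "j \<in> I"
    then show "(\<Sum>k\<in>I. M i k * N' k j) = (if i = j then 1 else 0)"
      using R by (simp add: N'_def)
  next
    fix i j assume "i \<in> I" "j \<in> I"
    then show "(\<Sum>k\<in>I. N' i k * M k j) = (if i = j then 1 else 0)"
      using symmetric_right_inverse_imp_left[OF fin sym R] by (simp add: N'_def)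
  next
    fix K
    assume K: "(\<forall>i\<in>I. \<forall>j\<in>I. (\<Sum>k\<in>I. M i k * K k j) = (if i = j then 1 else 0)) \<and>
      (\<forall>i\<in>I. \<forall>j\<in>I. (\<Sum>k\<in>I. K i k * M k j) = (if i = j then 1 else 0)) \<and>
      (\<forall>i j. i \<notin> I \<or> j \<notin> I \<longrightarrow> K i j = 0)"
    show "K = N'"
    proof (intro ext)
      fix i j
      show "K i j = N' i j"
      proof (cases "i \<in> I \<and> j \<in> I")
        case True
        then show ?thesis
          using left_inverse_eq_right_inverse_on[of I i j K M N] fin K R by (simp add: N'_def)
      qed (use K in \<open>auto simp: N'_def\<close>)
    qed
  qed (auto simp: N'_def)
  then show ?thesis using ij by (simp add: N'_def)
qed

text \<open>\<open>cheb I a n\<close> is U_{n-1}(A), with A minus the off-diagonal part of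
  \<open>a\<close>. The shift makes it directly the coefficient of t^n, and
  \<open>cheb I a 0 = 0\<close> is U_{-1}.\<close>

fun cheb :: "'a set \<Rightarrow> ('a \<Rightarrow> 'a \<Rightarrow> 'b :: field) \<Rightarrow> nat \<Rightarrow> 'a \<Rightarrow> 'a \<Rightarrow> 'b" where
  "cheb I a 0 i j = 0"
| "cheb I a (Suc 0) i j = (if i = j then 1 else 0)"
| "cheb I a (Suc (Suc n)) i j = - (\<Sum>k\<in>I - {i}. a i k * cheb I a (Suc n) k j) - cheb I a n i j"

text \<open>The inverse of \<open>(t + t\<^sup>-\<^sup>1) - A\<close> is \<open>\<Sum>n. U\<^sub>n(A) t\<^sup>n\<^sup>+\<^sup>1\<close>, where the \<open>U\<^sub>n\<close> are the (rescaled)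
  Chebyshev polynomials of the second kind.\<close>

lemma chebyshev_inverse:
  fixes a :: "'a \<Rightarrow> 'a \<Rightarrow> 'b :: field"
  assumes fin: "finite I" and i: "i \<in> I"
  shows "(\<Sum>k\<in>I. (if i = k then fls_X + fls_X_inv else fls_const (a i k))
      * fps_to_fls (Abs_fps (\<lambda>n. cheb I a n k j))) = (if i = j then 1 else 0)"
    (is "(\<Sum>k\<in>I. ?M k * ?N k) = _")
proof (rule fls_eqI)
  fix n
  have "(\<Sum>k\<in>I. ?M k * ?N k) = ?M i * ?N i + (\<Sum>k\<in>I - {i}. ?M k * ?N k)"
    using fin i by (rule sum.remove)
  also have "(\<Sum>k\<in>I - {i}. ?M k * ?N k) = (\<Sum>k\<in>I - {i}. fls_const (a i k) * ?N k)"
    by (intro sum.cong) auto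
  also have "?M i * ?N i = fls_shift (-1) (?N i) + fls_shift 1 (?N i)"
    by (simp add: distrib_right fls_X_times_conv_shift fls_X_inv_times_conv_shift)
  finally have eq: "fls_nth (\<Sum>k\<in>I. ?M k * ?N k) n
    = fls_nth (?N i) (n - 1) + fls_nth (?N i) (n + 1)
      + (\<Sum>k\<in>I - {i}. a i k * fls_nth (?N k) n)"
    by (simp add: fls_nth_sum)
  \<comment> \<open>At n = -1 only the vanishing term \<open>cheb I a 0\<close> appears, at n = 0
    the identity \<open>cheb I a 1\<close>, and for positive n the coefficient is zero by the
    recursion.\<close>
  consider "n < 0" | "n = 0" | m where "n = int (Suc m)"
    by (metis int_cases not0_implies_Suc of_nat_0 negative_zless)
  then show "fls_nth (\<Sum>k\<in>I. ?M k * ?N k) n = fls_nth (if i = j then 1 else 0) n"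
  proof cases
    case 1
    then show ?thesis unfolding eq by (cases "n = -1") auto
  next
    case 2
    then show ?thesis unfolding eq by simp
  next
    case 3
    have "nat (2 + int m) = Suc (Suc m)" "nat (1 + int m) = Suc m" by simp_all
    then show ?thesis unfolding eq by (simp add: 3)
  qed
qed

subsection \<open>The folded matrix\<close>

context folding
begin

abbreviation "B\<^sub>I \<equiv> B_matrix I c"
abbreviation "N\<^sub>I \<equiv> B_tilde I c"

lemma B_matrix_I:
  assumes "i \<in> I" "j \<in> I"
  shows "B\<^sub>I i j = (if i = j then fls_X + fls_X_inv else fls_const (of_int (c i j)))"
  using assms half_norm_unfolded[of i] half_norm_unfolded[of j] by (simp add: B_matrix_def)

lemma B_matrix_I_sym: "i \<in> I \<Longrightarrow> j \<in> I \<Longrightarrow> B\<^sub>I i j = B\<^sub>I j i"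
  by (simp add: B_matrix_I c_sym[of i j])

lemma B_tilde_inverse:
  assumes "i \<in> I" "j \<in> I"
  shows "(\<Sum>k\<in>I. B\<^sub>I i k * N\<^sub>I k j) = (if i = j then 1 else 0)"
proof -
  define N where "N k j = fps_to_fls (Abs_fps (\<lambda>n. cheb I (\<lambda>i j. of_int (c i j) :: rat) n k j))" for k j
  have N: "(\<Sum>k\<in>I. B\<^sub>I i k * N k j) = (if i = j then 1 else 0)" if "i \<in> I" "j \<in> I" for i j
  proof -
    have "(\<Sum>k\<in>I. B\<^sub>I i k * N k j)
      = (\<Sum>k\<in>I. (if i = k then fls_X + fls_X_inv else fls_const (of_int (c i k))) * N k j)"
      using that by (intro sum.cong refl) (simp add: B_matrix_I)
    then show ?thesis
      using chebyshev_inverse[OF finite_I that(1), of "\<lambda>i j. of_int (c i j)" j] by (simp add: N_def)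
  qed
  have "N\<^sub>I k j = N k j" if "k \<in> I" for k
    unfolding B_tilde_def using finite_I B_matrix_I_sym N that assms(2) by (rule matrix_inverse_on_eq)
  then have "(\<Sum>k\<in>I. B\<^sub>I i k * N\<^sub>I k j) = (\<Sum>k\<in>I. B\<^sub>I i k * N k j)"
    by (intro sum.cong refl) simp
  then show ?thesis using N[OF assms] by simp
qed

text \<open>The relabelled inverse is again inverse to the \<sigma>-invariant matrix, so uniqueness
  applies.\<close>

lemma B_tilde_\<sigma>:
  assumes "i \<in> I" "j \<in> I"
  shows "N\<^sub>I (\<sigma> i) (\<sigma> j) = N\<^sub>I i j"
proof -
  have "(\<Sum>k\<in>I. B\<^sub>I i k * N\<^sub>I (\<sigma> k) (\<sigma> j)) = (if i = j then 1 else 0)" if "i \<in> I" "j \<in> I" for i j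
  proof -
    have "(\<Sum>k\<in>I. B\<^sub>I i k * N\<^sub>I (\<sigma> k) (\<sigma> j)) = (\<Sum>k\<in>I. B\<^sub>I (\<sigma> i) (\<sigma> k) * N\<^sub>I (\<sigma> k) (\<sigma> j))"
      using that permutes_inj[OF perm]
      by (intro sum.cong refl) (simp add: B_matrix_I aut inj_eq)
    also have "\<dots> = (\<Sum>k\<in>I. B\<^sub>I (\<sigma> i) k * N\<^sub>I k (\<sigma> j))"
      by (rule sum.reindex_bij_betw[OF permutes_imp_bij[OF perm], of "\<lambda>k. B\<^sub>I (\<sigma> i) k * N\<^sub>I k (\<sigma> j)"])
    also have "\<dots> = (if i = j then 1 else 0)"
      using that permutes_inj[OF perm] by (simp add: B_tilde_inverse inj_eq)
    finally show ?thesis .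
  qed
  from matrix_inverse_on_eq[of I "B\<^sub>I" "\<lambda>i j. N\<^sub>I (\<sigma> i) (\<sigma> j)", OF finite_I B_matrix_I_sym this assms]
  show ?thesis by (simp add: B_tilde_def)
qed

lemma sum_B_tilde_orbit:
  assumes "p \<in> V" "q \<in> V" "i \<in> p" "j \<in> p"
  shows "(\<Sum>k\<in>q. N\<^sub>I i k) = (\<Sum>k\<in>q. N\<^sub>I j k)"
proof (rule orbit_invariant[OF _ assms(1,3,4)])
  fix i assume i: "i \<in> I"
  have "(\<Sum>k\<in>q. N\<^sub>I (\<sigma> i) k) = (\<Sum>k\<in>q. N\<^sub>I (\<sigma> i) (\<sigma> k))" by (simp add: sum_\<sigma>[OF assms(2)])
  also have "\<dots> = (\<Sum>k\<in>q. N\<^sub>I i k)"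
    using i V_subset_I[OF assms(2)] by (intro sum.cong refl) (auto intro: B_tilde_\<sigma>)
  finally show "(\<Sum>k\<in>q. N\<^sub>I (\<sigma> i) k) = (\<Sum>k\<in>q. N\<^sub>I i k)" .
qed

lemma B_matrix_fold:
  assumes "p \<in> V" "q \<in> V"
  shows "B_matrix V C p q = fls_const (inverse (of_nat (card q))) *
    (if p = q then fls_X + fls_X_inv else fls_const (of_int (C p q)))"
  using assms by (simp add: B_matrix_def half_norm_fold mult.commute)

lemma B_matrix_fold_sym:
  assumes pq: "p \<in> V" "q \<in> V"
  shows "B_matrix V C p q = B_matrix V C q p"
proof (cases "p = q")
  case False
  have "(of_int (d\<^sub>V p * C p q) :: rat) = of_int (d\<^sub>V q * C q p)"
    using fold.d_sym[OF pq] by simp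
  then have "inverse (of_nat (card q)) * of_int (C p q) = (inverse (of_nat (card p)) * of_int (C q p) :: rat)"
    using card_V_pos[OF pq(1)] card_V_pos[OF pq(2)] by (simp add: field_simps)
  then show ?thesis using False by (simp add: B_matrix_fold pq)
qed simp

text \<open>For constant \<open>f\<close> the sum is |q| times one value, cancelling the weight
  1/|q|. What remains is the row sum over \<open>q\<close>: t + 1/t if \<open>p = q\<close>, as
  orbit members are not adjacent, and the folded Cartan entry otherwise.\<close>

lemma B_matrix_fold_times_sum:
  assumes pq: "p \<in> V" "q \<in> V" and i: "i \<in> p"
    and const: "\<And>j j'. j \<in> q \<Longrightarrow> j' \<in> q \<Longrightarrow> f j = f j'"
  shows "B_matrix V C p q * (\<Sum>j\<in>q. f j) = (\<Sum>j\<in>q. B\<^sub>I i j * f j)"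
proof -
  obtain j\<^sub>0 where j0: "j\<^sub>0 \<in> q" using V_nonempty pq by blast
  have qI: "j \<in> I" if "j \<in> q" for j using that V_subset_I pq by blast
  have iI: "i \<in> I" using i V_subset_I pq by blast
  have "(\<Sum>j\<in>q. f j) = (\<Sum>j\<in>q. f j\<^sub>0)" using const j0 by (intro sum.cong refl) blast
  then have sum_f: "(\<Sum>j\<in>q. f j) = fls_const (of_nat (card q)) * f j\<^sub>0"
    by (simp add: fls_of_nat)
  have inv: "fls_const (inverse (of_nat (card q))) * fls_const (of_nat (card q) :: rat) = 1"
    unfolding fls_const_mult_const using card_V_pos[OF pq(2)] by simp
  let ?m = "if p = q then fls_X + fls_X_inv else fls_const (of_int (C p q))"
  have "B_matrix V C p q * (\<Sum>j\<in>q. f j)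
      = (fls_const (inverse (of_nat (card q))) * fls_const (of_nat (card q))) * (?m * f j\<^sub>0)"
    by (simp only: B_matrix_fold[OF pq] sum_f mult_ac)
  then have lhs: "B_matrix V C p q * (\<Sum>j\<in>q. f j) = ?m * f j\<^sub>0"
    by (simp only: inv mult_1)
  have "(\<Sum>j\<in>q. B\<^sub>I i j * f j) = (\<Sum>j\<in>q. B\<^sub>I i j) * f j\<^sub>0"
    unfolding sum_distrib_right
  proof (rule sum.cong[OF refl])
    fix j assume "j \<in> q"
    then have "f j = f j\<^sub>0" using const j0 by blast
    then show "B\<^sub>I i j * f j = B\<^sub>I i j * f j\<^sub>0" by (rule arg_cong)
  qed
  also have "(\<Sum>j\<in>q. B\<^sub>I i j) = (if p = q then fls_X + fls_X_inv else fls_const (of_int (C p q)))"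
  proof (cases "p = q")
    case True
    have "(\<Sum>j\<in>q. B\<^sub>I i j) = B\<^sub>I i i + (\<Sum>j\<in>q - {i}. B\<^sub>I i j)"
      using True i finite_V_mem pq by (intro sum.remove) auto
    also have "(\<Sum>j\<in>q - {i}. B\<^sub>I i j) = 0"
      using True i pq iI qI c_orbit[of q i] by (intro sum.neutral) (auto simp: B_matrix_I)
    finally show ?thesis using True iI by (simp add: B_matrix_I)
  next
    case False
    then have "i \<notin> q" using pq i in_V_iff by blast
    then have "(\<Sum>j\<in>q. B\<^sub>I i j) = (\<Sum>j\<in>q. fls_const (of_int (c i j)))"
      using iI qI by (intro sum.cong refl) (auto simp: B_matrix_I)
    also have "\<dots> = fls_const (of_int (C p q))"
      unfolding fold_cartan_eq[OF pq i] by (rule fls_eqI) (simp add: fls_nth_sum)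
    finally show ?thesis using False by simp
  qed
  finally show ?thesis using lhs by simp
qed

text \<open>Partial sums of the inverse over a column orbit are constant on row orbits. So the
  folded product at \<open>p\<close>, \<open>r\<close> becomes a full product over \<open>I\<close>
  in the row of one representative \<open>i\<close> of \<open>p\<close>.\<close>

lemma B_tilde_fold:
  assumes "p \<in> V" "q \<in> V"
  shows "B_tilde V C p q = (\<Sum>i\<in>p. \<Sum>j\<in>q. N\<^sub>I i j)"
  unfolding B_tilde_def[of V]
proof (rule matrix_inverse_on_eq[OF finite_V B_matrix_fold_sym _ assms])
  fix p r assume pr: "p \<in> V" "r \<in> V"
  obtain i where i: "i \<in> p" using V_nonempty pr by blast
  then have iI: "i \<in> I" using V_subset_I pr by blast
  have "(\<Sum>q\<in>V. B_matrix V C p q * (\<Sum>j\<in>q. \<Sum>k\<in>r. N\<^sub>I j k))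
    = (\<Sum>q\<in>V. \<Sum>j\<in>q. B\<^sub>I i j * (\<Sum>k\<in>r. N\<^sub>I j k))"
  proof (rule sum.cong[OF refl])
    fix q assume q: "q \<in> V"
    show "B_matrix V C p q * (\<Sum>j\<in>q. \<Sum>k\<in>r. N\<^sub>I j k) = (\<Sum>j\<in>q. B\<^sub>I i j * (\<Sum>k\<in>r. N\<^sub>I j k))"
      by (rule B_matrix_fold_times_sum[OF pr(1) q i]) (rule sum_B_tilde_orbit[OF q pr(2)])
  qed
  also have "\<dots> = (\<Sum>j\<in>I. B\<^sub>I i j * (\<Sum>k\<in>r. N\<^sub>I j k))" by (simp add: sum_orbits)
  also have "\<dots> = (\<Sum>k\<in>r. \<Sum>j\<in>I. B\<^sub>I i j * N\<^sub>I j k)"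
    unfolding sum_distrib_left by (rule sum.swap)
  also have "\<dots> = (\<Sum>k\<in>r. if i = k then 1 else 0)"
    using iI V_subset_I[OF pr(2)] by (intro sum.cong refl B_tilde_inverse) auto
  also have "\<dots> = (if p = r then 1 else 0)"
    using finite_V_mem[OF pr(2)] in_V_iff[OF pr(1), of i] in_V_iff[OF pr(2), of i] i by simp
  finally show "(\<Sum>q\<in>V. B_matrix V C p q * (\<Sum>j\<in>q. \<Sum>k\<in>r. N\<^sub>I j k)) = (if p = r then 1 else 0)" .
qed

lemma d_tilde_fold:
  assumes pq: "p \<in> V" "q \<in> V"
  shows "d_tilde V C p q = (\<Sum>i\<in>p. \<Sum>j\<in>q. d_tilde I c i j)"
proof -
  have star: "dynkin_star V C q \<in> V" using pq(2) by (rule fold.dynkin_star(1))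
  have inj: "inj_on (dynkin_star I c) q"
    using inj_on_dynkin_star V_subset_I[OF pq(2)] by (rule inj_on_subset)
  have "B_tilde V C p (dynkin_star V C q) = (\<Sum>i\<in>p. \<Sum>j\<in>dynkin_star V C q. N\<^sub>I i j)"
    using pq(1) star by (rule B_tilde_fold)
  also have "\<dots> = (\<Sum>i\<in>p. \<Sum>j\<in>q. N\<^sub>I i (dynkin_star I c j))"
    using inj by (simp add: dynkin_star_fold[OF pq(2)] sum.reindex)
  finally show ?thesis
    by (simp add: d_tilde_def coxeter_number_fold B_tilde_fold[OF pq] sum.distrib sum_distrib_left)
qed

end

lemma orbit_cong:
  assumes "i \<in> I" "\<And>j. j \<in> I \<Longrightarrow> g j = f j" "\<And>j. j \<in> I \<Longrightarrow> f j \<in> I"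
  shows "orbit g i = orbit f i"
proof -
  have "(g ^^ n) i = (f ^^ n) i \<and> (f ^^ n) i \<in> I" for n
    using assms by (induction n) auto
  then show ?thesis by (simp add: orbit_altdef)
qed

theorem theorem3p7:
  fixes I :: "'a set" and c :: "'a \<Rightarrow> 'a \<Rightarrow> int" and \<sigma> :: "'a \<Rightarrow> 'a"
  assumes "finite_dynkin I c"
    and "simply_laced I c"
    and "diagram_automorphism I c \<sigma>"
    and "\<not> (\<exists>i\<in>I. adjacent c i (\<sigma> i))"
  shows "\<forall>i\<in>fold_vertices I \<sigma>. \<forall>j\<in>fold_vertices I \<sigma>.
     d_tilde (fold_vertices I \<sigma>) (fold_cartan I c \<sigma>) i j =
       (\<Sum>i'\<in>fold_fibre I \<sigma> i. \<Sum>j'\<in>fold_fibre I \<sigma> j. d_tilde I c i' j')"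
proof -
  \<comment> \<open>The hypotheses constrain \<sigma> only on \<open>I\<close>, whereas
    \<open>permutes\<close> needs the identity outside; orbits of vertices are unchanged.\<close>
  define \<tau> where "\<tau> i = (if i \<in> I then \<sigma> i else i)" for i
  have bij: "bij_betw \<sigma> I I" and aut: "\<And>i j. i \<in> I \<Longrightarrow> j \<in> I \<Longrightarrow> c (\<sigma> i) (\<sigma> j) = c i j"
    using assms(3) by (auto simp: diagram_automorphism_def)
  have conn: "connected_diagram I c" using assms(1) by (simp add: finite_dynkin_def)
  have "bij_betw \<tau> I I" using bij by (rule bij_betw_cong[THEN iffD1, rotated]) (simp add: \<tau>_def)
  then have perm: "\<tau> permutes I" by (rule bij_imp_permutes) (simp add: \<tau>_def)
  have aut\<tau>: "c (\<tau> i) (\<tau> j) = c i j" if "i \<in> I" "j \<in> I" for i j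
    using that aut by (simp add: \<tau>_def)
  have orb: "orbit \<sigma> i = orbit \<tau> i" if "i \<in> I" for i
    using that bij by (intro orbit_cong[of i I]) (auto simp: \<tau>_def dest: bij_betwE)
  have fold_eq: "fold_vertices I \<sigma> = fold_vertices I \<tau>" "fold_fibre I \<sigma> = fold_fibre I \<tau>"
    "fold_cartan I c \<sigma> = fold_cartan I c \<tau>"
    using orb by (auto simp: fold_vertices_def fold_fibre_def fold_cartan_def fun_eq_iff cong: conj_cong)
  interpret coherent_cartan I c "\<lambda>_. 1"
    using assms(1,2) by (rule simply_laced_coherent)
  have "\<exists>i\<in>I. \<tau> i = i"
  proof (rule automorphism_fixes_vertex[OF perm aut\<tau> conn])
    fix i assume "i \<in> I"
    then show "\<not> adjacent c i (\<tau> i)" using assms(4) by (auto simp: \<tau>_def)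
  qed
  then obtain f where f: "f \<in> I" "\<tau> f = f" by blast
  interpret folding I c \<tau>
    by unfold_locales
      (use perm aut\<tau> conn f orbit_not_adjacent[OF perm aut\<tau> conn f] in auto)
  show ?thesis
    unfolding fold_eq using d_tilde_fold by (simp add: fibre_eq)
qed

end
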